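(* Let $n\ge 9$. Among all connected graphs $G$ of order $n$, the quantity $\mathrm{W}(G)-\varepsilon(G)$ is maximized by the path $P_n$, and $P_n$ is the unique graph attaining this maximum.
   Context: $\mathrm{W}(G)=\sum_{\{u,v\}\subset V(G)} d(u,v)$ is the Wiener index (sum of distances over unordered pairs of distinct vertices). The eccentricity of a vertex $v$ is $\max_{u\in V(G)} d(u,v)$, and $\varepsilon(G)$ is the sum of the eccentricities of all vertices of $G$. *)

theory Defs
  imports "Graph_Theory.Graph_Theory"
begin

text \<open>
  Finite simple graphs are the locale \<open>graph\<close>: finite loop-free digraphs without parallel
  arcs whose arc relation is symmetric, so that every edge is a pair of opposite arcs.
\<close>

text \<open>Shortest-path length, every arc having cost 1. For vertices that are not connected by a
  walk the infimum is \<open>\<infinity>\<close> and the value below is the junk value 0.\<close>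

definition gdist :: "('a,'b) pre_digraph \<Rightarrow> 'a \<Rightarrow> 'a \<Rightarrow> real" where
  "gdist G u v = real_of_ereal (wf_digraph.\<mu> G (\<lambda>_. 1) u v)"

text \<open>The distance depends only on the unordered pair, since a walk in a symmetric digraph can be
  reversed; the lemma \<open>pair_dist_eq\<close> below shows that the description is well-defined.\<close>

definition pair_dist :: "('a,'b) pre_digraph \<Rightarrow> 'a set \<Rightarrow> real" where
  "pair_dist G e = (THE d. \<forall>u v. e = {u, v} \<longrightarrow> d = gdist G u v)"

definition wiener_index :: "('a,'b) pre_digraph \<Rightarrow> real" where
  "wiener_index G = (\<Sum>e | e \<subseteq> verts G \<and> card e = 2. pair_dist G e)"

definition eccentricity :: "('a,'b) pre_digraph \<Rightarrow> 'a \<Rightarrow> real" where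
  "eccentricity G v = Max ((\<lambda>u. gdist G u v) ` verts G)"

definition total_eccentricity :: "('a,'b) pre_digraph \<Rightarrow> real" where
  "total_eccentricity G = (\<Sum>v\<in>verts G. eccentricity G v)"

definition path_graph :: "nat \<Rightarrow> (nat, nat \<times> nat) pre_digraph" where
  "path_graph n = with_proj
     \<lparr> pverts = {..<n}, parcs = {(i, j). i < n \<and> j < n \<and> (j = Suc i \<or> i = Suc j)} \<rparr>"

lemma (in sym_digraph) awalk_reverse:
  assumes "awalk u p v"
  shows "\<exists>q. awalk v q u \<and> length q = length p"
  using assms
proof (induction p arbitrary: u)
  case Nil
  then show ?case
    by (intro exI[of _ "[]"]) (auto simp: awalk_Nil_iff)
next
  case (Cons e p)
  then have e: "e \<in> arcs G" "tail G e = u" and p: "awalk (head G e) p v"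
    by (auto simp: awalk_Cons_iff)
  obtain q where q: "awalk v q (head G e)" "length q = length p"
    using Cons.IH[OF p] by blast
  have "(u, head G e) \<in> arcs_ends G"
    using e by (auto simp: arcs_ends_def arc_to_ends_def)
  then have "(head G e, u) \<in> arcs_ends G"
    using sym_arcs unfolding symmetric_def by (rule symD[rotated])
  then obtain e' where e': "e' \<in> arcs G" "tail G e' = head G e" "head G e' = u"
    by (auto simp: arcs_ends_def arc_to_ends_def)
  then have "awalk (head G e) [e'] u"
    by (auto simp: awalk_Cons_iff awalk_Nil_iff)
  then have "awalk v (q @ [e']) u"
    using q(1) by (rule awalk_appendI[rotated])
  then show ?case
    using q(2) by (intro exI[of _ "q @ [e']"]) auto
qed

lemma (in sym_digraph) gdist_commute: "gdist G u v = gdist G v u"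
proof -
  have cost: "awalk_cost (\<lambda>_. 1) p = real (length p)" for p
    by (induction p) auto
  have sub: "(\<lambda>p. ereal (awalk_cost (\<lambda>_. 1) p)) ` {p. awalk a p b}
      \<subseteq> (\<lambda>p. ereal (awalk_cost (\<lambda>_. 1) p)) ` {p. awalk b p a}" for a b
  proof safe
    fix p assume "awalk a p b"
    then obtain q where "awalk b q a" "length q = length p"
      using awalk_reverse by blast
    then show "ereal (awalk_cost (\<lambda>_. 1) p)
        \<in> (\<lambda>p. ereal (awalk_cost (\<lambda>_. 1) p)) ` {p. awalk b p a}"
      by (intro image_eqI[of _ _ q]) (auto simp: cost)
  qed
  have "\<mu> (\<lambda>_. 1) u v = \<mu> (\<lambda>_. 1) v u"
    unfolding \<mu>_def using sub[of u v] sub[of v u] by (simp add: subset_antisym)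
  then show ?thesis
    unfolding gdist_def by simp
qed

lemma (in sym_digraph) pair_dist_eq: "pair_dist G {u, v} = gdist G u v"
  unfolding pair_dist_def
  by (rule the_equality) (auto simp: doubleton_eq_iff gdist_commute)

end

theory Submission
  imports Defs
begin

text \<open>
  Fix a diametral path \<open>v 0, \<dots>, v d\<close> and add the remaining \<open>m\<close> vertices one at a time, each
  adjacent to what is already there. For a new vertex \<open>w\<close>, summing over radii \<open>r < d\<close> the number of
  earlier vertices outside the ball of radius \<open>r\<close> gives its contribution to the Wiener index, and
  its eccentricity is paid for in the same sum. Such a ball contains at least \<open>r\<close> earlier vertices;
  every further vertex is a gain over the estimate, and the theorem reduces to the inequality
  \<open>12 \<Gamma> > 6dm + 8m + 3m\<^sup>2 + 3 - 2m\<^sup>3\<close> for the total gain \<open>\<Gamma>\<close>.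

  If every off-path vertex reaches an inner path vertex without using \<open>v 0\<close> or \<open>v d\<close>, order the
  vertices by their distance \<open>\<rho>\<close> to the inner path in that sense. Beyond radius \<open>\<rho>\<close> the ball spreads
  in both directions along the path, so each radius in \<open>\<rho> < r < d\<close> gains at least one. This suffices
  unless just one vertex is attached to the inner path, and then the gain of the others has to be
  improved slightly. Otherwise some off-path vertices connect \<open>v 0\<close> to \<open>v d\<close> avoiding the inner path,
  which closes a long cycle; the last vertex of that cycle to be added gains \<open>r\<close> at every radius.
\<close>

section \<open>Balls around off-path vertices\<close>

text \<open>The extremal argument uses only the distance function. Adjacency is
  \<open>D x y = 1\<close>, and \<open>D_step\<close>, the first step of a shortest walk, is what
  separates graph metrics from other integer-valued metrics.\<close>

locale graph_metric =
  fixes V :: "'a set" and D :: "'a \<Rightarrow> 'a \<Rightarrow> nat"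
  assumes finite_V: "finite V"
    and D_eq_0_iff: "x \<in> V \<Longrightarrow> y \<in> V \<Longrightarrow> D x y = 0 \<longleftrightarrow> x = y"
    and D_sym: "x \<in> V \<Longrightarrow> y \<in> V \<Longrightarrow> D x y = D y x"
    and D_triangle: "x \<in> V \<Longrightarrow> y \<in> V \<Longrightarrow> z \<in> V \<Longrightarrow> D x z \<le> D x y + D y z"
    and D_step: "x \<in> V \<Longrightarrow> y \<in> V \<Longrightarrow> D x y = Suc k \<Longrightarrow> \<exists>z\<in>V. D x z = 1 \<and> D z y = k"
begin

definition ecc :: "'a \<Rightarrow> nat" where
  "ecc x = Max (D x ` V)"

text \<open>The double sum counts each unordered pair twice, hence the factor 2 on the
  eccentricities: the value is twice the quantity to be maximized.\<close>

definition excess :: int where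
  "excess = (\<Sum>x\<in>V. \<Sum>y\<in>V. int (D x y)) - 2 * (\<Sum>x\<in>V. int (ecc x))"

lemma D_le_ecc: "y \<in> V \<Longrightarrow> D x y \<le> ecc x"
  unfolding ecc_def by (rule Max_ge) (auto simp: finite_V)

text \<open>Induction on the distance: \<open>x\<close> is put in front of a geodesic from the next
  vertex. With truncated subtraction \<open>(i - j) + (j - i)\<close> is |i - j|, here and
  throughout.\<close>

lemma geodesic_exists:
  assumes "x \<in> V" "y \<in> V" "D x y = k"
  shows "\<exists>v. v 0 = x \<and> v k = y \<and> (\<forall>i\<le>k. v i \<in> V) \<and>
    (\<forall>i\<le>k. \<forall>j\<le>k. D (v i) (v j) = (i - j) + (j - i))"
  using assms
proof (induction k arbitrary: x)
  case 0
  then show ?case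
    by (intro exI[of _ "\<lambda>_. x"]) (auto simp: D_eq_0_iff)
next
  case (Suc k)
  obtain z where z: "z \<in> V" "D x z = 1" "D z y = k"
    using D_step Suc.prems by blast
  obtain v where v: "v 0 = z" "v k = y" "\<And>i. i \<le> k \<Longrightarrow> v i \<in> V"
    "\<And>i j. i \<le> k \<Longrightarrow> j \<le> k \<Longrightarrow> D (v i) (v j) = (i - j) + (j - i)"
    using Suc.IH[OF z(1) Suc.prems(2) z(3)] by blast
  define u where "u = case_nat x v"
  have Dx: "D x (v j) = Suc j" if "j \<le> k" for j
  proof (rule antisym)
    show "D x (v j) \<le> Suc j"
      using D_triangle[of x z "v j"] v(4)[of 0 j] v(1) that z Suc.prems v(3)[OF that] by auto
    show "Suc j \<le> D x (v j)"
      using D_triangle[of x "v j" y] v(4)[of j k] v(2) that Suc.prems v(3)[OF that] by auto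
  qed
  have "D (u i) (u j) = (i - j) + (j - i)" if "i \<le> Suc k" "j \<le> Suc k" for i j
    using that Suc.prems v(3,4) Dx D_sym[of "v _" x]
    by (cases i; cases j) (auto simp: u_def D_eq_0_iff)
  moreover have "u 0 = x" "u (Suc k) = y" "\<And>i. i \<le> Suc k \<Longrightarrow> u i \<in> V"
    using Suc.prems v by (auto simp: u_def split: nat.split)
  ultimately show ?case
    by blast
qed

end

locale diametral_path = graph_metric +
  fixes v :: "nat \<Rightarrow> 'a" and d :: nat
  assumes v_in: "i \<le> d \<Longrightarrow> v i \<in> V"
    and D_v: "i \<le> d \<Longrightarrow> j \<le> d \<Longrightarrow> D (v i) (v j) = (i - j) + (j - i)"
    and D_le: "x \<in> V \<Longrightarrow> y \<in> V \<Longrightarrow> D x y \<le> d"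
begin

definition P :: "'a set" where
  "P = v ` {..d}"

definition X :: "'a set" where
  "X = V - P"

text \<open>In \<open>H f w\<close> the map \<open>f\<close> numbers the off-path vertices in the order of their addition.\<close>

definition H :: "('a \<Rightarrow> nat) \<Rightarrow> 'a \<Rightarrow> 'a set" where
  "H f w = P \<union> {x \<in> X. f x < f w}"

definition ball_size :: "('a \<Rightarrow> nat) \<Rightarrow> nat \<Rightarrow> 'a \<Rightarrow> nat" where
  "ball_size f r w = card {y \<in> H f w. D w y \<le> r}"

text \<open>Truncated subtraction loses nothing once every ball of radius \<open>r\<close> has at
  least \<open>r\<close> points. Radius 0 is left out: an off-path \<open>w\<close> is not in
  \<open>H f w\<close>, so that ball is empty.\<close>

definition gain :: "('a \<Rightarrow> nat) \<Rightarrow> 'a \<Rightarrow> nat" where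
  "gain f w = (\<Sum>r\<in>{1..<d}. min (ball_size f r w) (card (H f w) - 1) - r)"

lemma inj_v: "inj_on v {..d}"
proof (rule inj_onI)
  fix i j assume "i \<in> {..d}" "j \<in> {..d}" "v i = v j"
  then show "i = j"
    using D_v[of i j] D_eq_0_iff[of "v i" "v j"] v_in by auto
qed

lemma P_subset: "P \<subseteq> V"
  using v_in by (auto simp: P_def)

lemma X_subset: "X \<subseteq> V"
  by (auto simp: X_def)

lemma finite_P [simp]: "finite P" and finite_X [simp]: "finite X"
  using finite_V by (auto simp: P_def X_def)

lemma card_P: "card P = d + 1"
  unfolding P_def by (simp add: card_image inj_v)

lemma v_in_P [simp]: "i \<le> d \<Longrightarrow> v i \<in> P"
  by (auto simp: P_def)

lemma finite_H [simp]: "finite (H f w)"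
  by (simp add: H_def)

lemma P_Int_X: "P \<inter> X = {}"
  by (auto simp: X_def)

lemma P_Un_X: "P \<union> X = V"
  using P_subset by (auto simp: X_def)

lemma card_V: "card V = d + 1 + card X"
  using card_Un_disjoint[of P X] by (simp add: P_Int_X P_Un_X card_P)

lemma H_subset: "H f w \<subseteq> V"
  using P_subset X_subset by (auto simp: H_def)

lemma not_in_H: "w \<in> X \<Longrightarrow> w \<notin> H f w"
  by (auto simp: H_def X_def)

lemma ecc_le: "w \<in> V \<Longrightarrow> ecc w \<le> d"
  unfolding ecc_def using D_le finite_V by (subst Max_le_iff) auto

lemma card_H:
  assumes f: "bij_betw f X {1..card X}" and w: "w \<in> X"
  shows "card (H f w) = d + f w"
proof -
  have fw: "f w \<in> {1..card X}"
    using f w by (auto simp: bij_betw_def)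
  have "f ` {x \<in> X. f x < f w} = {1..<f w}"
  proof
    show "{1..<f w} \<subseteq> f ` {x \<in> X. f x < f w}"
    proof
      fix i assume i: "i \<in> {1..<f w}"
      then have "i \<in> f ` X"
        using fw f by (auto simp: bij_betw_def)
      then show "i \<in> f ` {x \<in> X. f x < f w}"
        using i by auto
    qed
  qed (use f in \<open>auto simp: bij_betw_def\<close>)
  moreover have "inj_on f {x \<in> X. f x < f w}"
    using f by (auto simp: bij_betw_def intro: inj_on_subset)
  ultimately have "card {x \<in> X. f x < f w} = f w - 1"
    using card_image by fastforce
  then show ?thesis
    unfolding H_def using fw by (subst card_Un_disjoint) (auto simp: card_P X_def finite_V)
qed

text \<open>A distance of at most \<open>d\<close> is the number of radii \<open>r < d\<close> below
  it; exchanging the two sums counts far points radius by radius.\<close>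

lemma sum_D_eq_sum_far:
  assumes "finite A" "\<And>y. y \<in> A \<Longrightarrow> D w y \<le> d"
  shows "(\<Sum>y\<in>A. int (D w y)) = (\<Sum>r<d. int (card A) - int (card {y \<in> A. D w y \<le> r}))"
proof -
  have "int (D w y) = (\<Sum>r<d. if r < D w y then 1 else 0)" if "y \<in> A" for y
  proof -
    have "{..<d} \<inter> {r. r < D w y} = {..<D w y}"
      using assms(2)[OF that] by auto
    then show ?thesis
      by (simp add: sum.If_cases)
  qed
  then have "(\<Sum>y\<in>A. int (D w y)) = (\<Sum>y\<in>A. \<Sum>r<d. if r < D w y then 1 else 0)"
    by simp
  also have "\<dots> = (\<Sum>r<d. \<Sum>y\<in>A. if r < D w y then 1 else 0)"
    by (rule sum.swap)
  also have "\<dots> = (\<Sum>r<d. int (card A) - int (card {y \<in> A. D w y \<le> r}))"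
  proof (rule sum.cong[OF refl])
    fix r
    have "card A = card {y \<in> A. D w y \<le> r} + card (A \<inter> {y. r < D w y})"
      using assms(1) by (subst card_Un_disjoint[symmetric]) (auto intro: arg_cong[where f = card])
    then show "(\<Sum>y\<in>A. if r < D w y then 1 else 0) = int (card A) - int (card {y \<in> A. D w y \<le> r})"
      using assms(1) by (simp add: sum.If_cases)
  qed
  finally show ?thesis .
qed

text \<open>The eccentricity is itself counted radius by radius, as the number of \<open>r < d\<close> that do
  not yet reach all of the graph. At a radius beyond the eccentricity the ball is everything, which
  is why \<open>gain\<close> truncates ball sizes at \<open>card (H f w) - 1\<close>.\<close>

lemma transmission_minus_ecc_le:
  assumes w: "w \<in> X" and f: "bij_betw f X {1..card X}"
    and ball: "\<And>r. 1 \<le> r \<Longrightarrow> r < d \<Longrightarrow> r \<le> ball_size f r w"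
  shows "(\<Sum>y\<in>H f w. int (D w y)) - int (ecc w)
    \<le> (\<Sum>r<d. int (d + f w) - 1 - int r) - int (gain f w)"
proof -
  let ?h = "card (H f w)"
  have h: "?h = d + f w" and fw: "1 \<le> f w"
    using card_H[OF f w] f w by (auto simp: bij_betw_def)
  have wV: "w \<in> V"
    using w X_subset by auto
  have D1: "(\<Sum>y\<in>H f w. int (D w y)) = (\<Sum>r<d. int ?h - int (ball_size f r w))"
    unfolding ball_size_def using H_subset wV by (intro sum_D_eq_sum_far) (auto intro: D_le)
  have "{..<d} \<inter> {r. r < ecc w} = {..<ecc w}"
    using ecc_le[OF wV] by auto
  then have E: "int (ecc w) = (\<Sum>r<d. if r < ecc w then 1 else 0)"
    by (simp add: sum.If_cases)
  have radius: "int ?h - int (ball_size f r w) - (if r < ecc w then 1 else 0)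
      \<le> int ?h - 1 - int (min (ball_size f r w) (?h - 1))" for r
  proof (cases "r < ecc w")
    case False
    then have "{y \<in> H f w. D w y \<le> r} = H f w"
      using D_le_ecc[of _ w] H_subset by fastforce
    then have "ball_size f r w = ?h"
      by (simp add: ball_size_def)
    then show ?thesis
      using False h fw by auto
  qed (use h fw in auto)
  have gain: "int (gain f w) = (\<Sum>r<d. int (min (ball_size f r w) (?h - 1)) - int r)"
  proof -
    have "D w y \<noteq> 0" if "y \<in> H f w" for y
      using that not_in_H[OF w] H_subset wV D_eq_0_iff by blast
    then have "ball_size f 0 w = 0"
      by (simp add: ball_size_def)
    then have "(\<Sum>r<d. int (min (ball_size f r w) (?h - 1)) - int r)
      = (\<Sum>r\<in>{1..<d}. int (min (ball_size f r w) (?h - 1)) - int r)"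
      by (intro sum.mono_neutral_right) (auto simp: Suc_le_eq)
    also have "\<dots> = (\<Sum>r\<in>{1..<d}. int (min (ball_size f r w) (?h - 1) - r))"
      using ball h fw by (intro sum.cong) (auto simp: of_nat_diff)
    finally show ?thesis
      by (simp add: gain_def)
  qed
  have "(\<Sum>y\<in>H f w. int (D w y)) - int (ecc w)
      = (\<Sum>r<d. int ?h - int (ball_size f r w) - (if r < ecc w then 1 else 0))"
    unfolding D1 E by (simp add: sum_subtractf)
  also have "\<dots> \<le> (\<Sum>r<d. int ?h - 1 - int (min (ball_size f r w) (?h - 1)))"
    by (rule sum_mono) (rule radius)
  also have "\<dots> = (\<Sum>r<d. int (d + f w) - 1 - int r) - int (gain f w)"
    unfolding gain by (simp add: sum_subtractf h)
  finally show ?thesis .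
qed

text \<open>Each pair of off-path vertices is charged to the one with the larger number, each mixed
  pair to its off-path vertex; symmetry gives the factor 2.\<close>

lemma sum_D_split:
  assumes f: "inj_on f X"
  shows "(\<Sum>x\<in>V. \<Sum>y\<in>V. int (D x y))
    = (\<Sum>x\<in>P. \<Sum>y\<in>P. int (D x y)) + 2 * (\<Sum>w\<in>X. \<Sum>y\<in>H f w. int (D w y))"
proof -
  let ?L = "\<lambda>w. {x \<in> X. f x < f w}" and ?U = "\<lambda>w. {x \<in> X. f w < f x}"
  have split: "(\<Sum>y\<in>V. g y) = (\<Sum>y\<in>P. g y) + (\<Sum>y\<in>X. g y)" for g :: "'a \<Rightarrow> int"
    using sum.union_disjoint[of P X g] by (simp add: P_Int_X P_Un_X)
  have sym: "(\<Sum>x\<in>P. \<Sum>y\<in>X. int (D x y)) = (\<Sum>w\<in>X. \<Sum>y\<in>P. int (D w y))"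
    using P_subset X_subset by (subst sum.swap) (auto intro!: sum.cong D_sym)
  have XX: "(\<Sum>y\<in>X. int (D w y)) = (\<Sum>y\<in>?L w. int (D w y)) + (\<Sum>y\<in>?U w. int (D w y))"
    if w: "w \<in> X" for w
  proof -
    have "X = insert w (?L w \<union> ?U w)"
      using w f by (auto simp: inj_on_def) (metis linorder_neqE_nat)
    then have "(\<Sum>y\<in>X. int (D w y)) = (\<Sum>y\<in>insert w (?L w \<union> ?U w). int (D w y))"
      by simp
    also have "\<dots> = int (D w w) + (\<Sum>y\<in>?L w \<union> ?U w. int (D w y))"
      by (rule sum.insert) auto
    also have "\<dots> = (\<Sum>y\<in>?L w. int (D w y)) + (\<Sum>y\<in>?U w. int (D w y))"
      using w X_subset D_eq_0_iff[of w w] by (subst sum.union_disjoint) auto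
    finally show ?thesis .
  qed
  have swap: "(\<Sum>w\<in>X. \<Sum>y\<in>?U w. int (D w y)) = (\<Sum>w\<in>X. \<Sum>y\<in>?L w. int (D w y))"
  proof -
    have "(\<Sum>w\<in>X. \<Sum>y\<in>?U w. int (D w y)) = (\<Sum>y\<in>X. \<Sum>w\<in>?L y. int (D w y))"
      by (rule sum.swap_restrict) auto
    also have "\<dots> = (\<Sum>y\<in>X. \<Sum>w\<in>?L y. int (D y w))"
      using X_subset by (intro sum.cong refl) (auto intro: D_sym)
    finally show ?thesis .
  qed
  have H: "(\<Sum>y\<in>H f w. int (D w y)) = (\<Sum>y\<in>P. int (D w y)) + (\<Sum>y\<in>?L w. int (D w y))" for w
    unfolding H_def using P_Int_X by (subst sum.union_disjoint) auto
  have "(\<Sum>x\<in>V. \<Sum>y\<in>V. int (D x y)) = (\<Sum>x\<in>P. \<Sum>y\<in>P. int (D x y))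
    + 2 * (\<Sum>w\<in>X. \<Sum>y\<in>P. int (D w y)) + (\<Sum>w\<in>X. \<Sum>y\<in>X. int (D w y))"
    by (simp add: split sum.distrib sym)
  also have "(\<Sum>w\<in>X. \<Sum>y\<in>X. int (D w y)) = 2 * (\<Sum>w\<in>X. \<Sum>y\<in>?L w. int (D w y))"
    using swap by (simp add: XX sum.distrib)
  finally show ?thesis
    by (simp add: H sum.distrib)
qed

lemma ecc_v_ge: "i \<le> d \<Longrightarrow> max i (d - i) \<le> ecc (v i)"
  using D_le_ecc[OF v_in[of 0], of "v i"] D_le_ecc[OF v_in[of d], of "v i"] D_v[of i 0] D_v[of i d]
  by auto

text \<open>Pairs on the path contribute exactly as in a path on \<open>d + 1\<close> vertices, and
  each path vertex has at least the eccentricity it has there. Off-path vertices enter through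
  \<open>transmission_minus_ecc_le\<close>, summed over their numbers.\<close>

lemma excess_le_gain:
  assumes f: "bij_betw f X {1..card X}"
    and ball: "\<And>w r. w \<in> X \<Longrightarrow> 1 \<le> r \<Longrightarrow> r < d \<Longrightarrow> r \<le> ball_size f r w"
  shows "excess \<le> (\<Sum>i\<le>d. \<Sum>j\<le>d. int ((i - j) + (j - i))) - 2 * (\<Sum>i\<le>d. int (max i (d - i)))
    + 2 * (\<Sum>k\<in>{1..card X}. \<Sum>r<d. int (d + k) - 1 - int r) - 2 * (\<Sum>w\<in>X. int (gain f w))"
proof -
  have PP: "(\<Sum>x\<in>P. \<Sum>y\<in>P. int (D x y)) = (\<Sum>i\<le>d. \<Sum>j\<le>d. int ((i - j) + (j - i)))"
    unfolding P_def by (simp add: sum.reindex[OF inj_v] D_v)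
  have "(\<Sum>i\<le>d. int (max i (d - i))) \<le> (\<Sum>i\<le>d. int (ecc (v i)))"
    by (intro sum_mono) (use ecc_v_ge in \<open>auto simp del: of_nat_max\<close>)
  also have "\<dots> = (\<Sum>x\<in>P. int (ecc x))"
    unfolding P_def by (simp add: sum.reindex[OF inj_v])
  finally have EP: "(\<Sum>i\<le>d. int (max i (d - i))) \<le> (\<Sum>x\<in>P. int (ecc x))" .
  have EV: "(\<Sum>x\<in>V. int (ecc x)) = (\<Sum>x\<in>P. int (ecc x)) + (\<Sum>x\<in>X. int (ecc x))"
    using sum.union_disjoint[of P X "\<lambda>x. int (ecc x)"] by (simp add: P_Int_X P_Un_X)
  have "(\<Sum>w\<in>X. (\<Sum>y\<in>H f w. int (D w y)) - int (ecc w))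
      \<le> (\<Sum>w\<in>X. (\<Sum>r<d. int (d + f w) - 1 - int r) - int (gain f w))"
    using transmission_minus_ecc_le[OF _ f] ball by (intro sum_mono) auto
  also have "\<dots> = (\<Sum>w\<in>X. \<Sum>r<d. int (d + f w) - 1 - int r) - (\<Sum>w\<in>X. int (gain f w))"
    by (simp only: sum_subtractf)
  also have "(\<Sum>w\<in>X. \<Sum>r<d. int (d + f w) - 1 - int r)
      = (\<Sum>k\<in>{1..card X}. \<Sum>r<d. int (d + k) - 1 - int r)"
    using sum.reindex_bij_betw[OF f, of "\<lambda>k. \<Sum>r<d. int (d + k) - 1 - int r"] .
  finally show ?thesis
    using sum_D_split[of f] f EP unfolding excess_def PP EV
    by (simp add: sum_subtractf bij_betw_def)
qed

end

section \<open>Ranked off-path vertices\<close>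

text \<open>The index ball of radius \<open>s\<close> around \<open>j\<close> has a full arm of
  length \<open>s\<close> on one side if there is room, and \<open>a\<close> further points on the
  other. If neither arm fits, the ball is all of \<open>{..d}\<close>.\<close>

lemma card_index_interval:
  fixes j d s a :: nat
  assumes "j \<le> d" "a \<le> j" "a \<le> d - j" "a \<le> s" "s + a \<le> d"
  shows "s + a + 1 \<le> card {i. i \<le> d \<and> (i - j) + (j - i) \<le> s}"
proof -
  have fin: "finite {i. i \<le> d \<and> (i - j) + (j - i) \<le> s}"
    by simp
  consider "j + s \<le> d" | "s \<le> j" | "d < j + s" "j < s"
    by linarith
  then show ?thesis
  proof cases
    case 1
    then have "{j - a..j + s} \<subseteq> {i. i \<le> d \<and> (i - j) + (j - i) \<le> s}"
      using assms by auto
    from card_mono[OF fin this] show ?thesis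
      using assms by simp
  next
    case 2
    then have "{j - s..j + a} \<subseteq> {i. i \<le> d \<and> (i - j) + (j - i) \<le> s}"
      using assms by auto
    from card_mono[OF fin this] show ?thesis
      using assms 2 by simp
  next
    case 3
    then have "{..d} \<subseteq> {i. i \<le> d \<and> (i - j) + (j - i) \<le> s}"
      using assms by auto
    from card_mono[OF fin this] show ?thesis
      using assms by simp
  qed
qed

text \<open>Sorting by \<rho>: an element of maximal rank gets the last number.\<close>

lemma exists_rank_enumeration:
  fixes \<rho> :: "'a \<Rightarrow> nat"
  assumes "finite A"
  shows "\<exists>f. bij_betw f A {1..card A} \<and> (\<forall>x\<in>A. \<forall>y\<in>A. \<rho> x < \<rho> y \<longrightarrow> f x < f y)"
  using assms
proof (induction "card A" arbitrary: A)
  case 0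
  then show ?case
    by (auto simp: bij_betw_def)
next
  case (Suc n)
  then have fin: "finite (\<rho> ` A)" "\<rho> ` A \<noteq> {}"
    by auto
  from Max_in[OF this] obtain z where z: "z \<in> A" "\<rho> z = Max (\<rho> ` A)"
    by auto
  have z_max: "\<rho> x \<le> \<rho> z" if "x \<in> A" for x
    using z that fin by auto
  let ?B = "A - {z}"
  have n: "n = card ?B"
    using Suc z by simp
  obtain f where f: "bij_betw f ?B {1..card ?B}"
    "\<forall>x\<in>?B. \<forall>y\<in>?B. \<rho> x < \<rho> y \<longrightarrow> f x < f y"
    using Suc.hyps(1)[OF n] Suc.prems by blast
  let ?g = "f(z := Suc n)"
  have "bij_betw ?g ?B {1..n}"
    using f(1) n by (subst bij_betw_cong[where g = f]) auto
  then have "bij_betw ?g (?B \<union> {z}) ({1..n} \<union> {Suc n})"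
    by (rule bij_betw_combine) auto
  moreover have "?B \<union> {z} = A" "{1..n} \<union> {Suc n} = {1..card A}"
    using z Suc.hyps(2) by auto
  moreover have "?g x < ?g y" if "x \<in> A" "y \<in> A" "\<rho> x < \<rho> y" for x y
  proof -
    have "x \<noteq> z"
      using that z_max[of y] by auto
    moreover have "f x \<le> n" if "x \<in> ?B"
      using f(1) n that by (auto simp: bij_betw_def)
    ultimately show ?thesis
      using f(2) that by (auto simp: less_Suc_eq_le)
  qed
  ultimately show ?case
    by (intro exI[of _ ?g]) auto
qed

section \<open>Distance to the path through off-path vertices\<close>

context diametral_path
begin

lemma X_not_P: "x \<in> X \<Longrightarrow> x \<in> V" "x \<in> X \<Longrightarrow> i \<le> d \<Longrightarrow> x \<noteq> v i"
  by (auto simp: X_def)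

lemma V_cases:
  assumes "x \<in> V"
  obtains (path) i where "i \<le> d" "x = v i" | (off) "x \<in> X"
  using assms by (auto simp: X_def P_def)

text \<open>This describes walks of \<open>k\<close> edges from \<open>w\<close> through off-path
  vertices to some \<open>v j\<close> with \<open>j \<in> T\<close>. So \<open>rank T\<close> is the
  distance to these path vertices after deletion of the other ones; without such a walk its value is
  arbitrary.\<close>

inductive layer :: "nat set \<Rightarrow> nat \<Rightarrow> 'a \<Rightarrow> bool" for T where
  layer_base: "w \<in> X \<Longrightarrow> j \<in> T \<Longrightarrow> D w (v j) = 1 \<Longrightarrow> layer T 1 w"
| layer_step: "layer T k x \<Longrightarrow> w \<in> X \<Longrightarrow> D w x = 1 \<Longrightarrow> layer T (Suc k) w"

definition rank :: "nat set \<Rightarrow> 'a \<Rightarrow> nat" where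
  "rank T w = (LEAST k. layer T k w)"

lemma layer_in_X: "layer T k w \<Longrightarrow> w \<in> X \<and> 1 \<le> k"
  by (induction rule: layer.induct) auto

lemma layer_rank: "layer T k w \<Longrightarrow> layer T (rank T w) w"
  unfolding rank_def by (rule LeastI)

lemma rank_le: "layer T k w \<Longrightarrow> rank T w \<le> k"
  unfolding rank_def by (rule Least_le)

lemma rank_ge_1: "layer T k w \<Longrightarrow> 1 \<le> rank T w"
  using layer_rank layer_in_X by blast

lemma rank_1_attached:
  assumes "layer T k w" "rank T w = 1"
  shows "\<exists>j\<in>T. D w (v j) = 1"
  using layer_rank[OF assms(1)] unfolding assms(2)
  by cases (auto dest: layer_in_X)

lemma rank_eq_1: "w \<in> X \<Longrightarrow> j \<in> T \<Longrightarrow> D w (v j) = 1 \<Longrightarrow> rank T w = 1"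
  using layer_base[of w j T] rank_le[of T 1 w] rank_ge_1[of T 1 w] by simp

lemma rank_le_Suc: "layer T k x \<Longrightarrow> w \<in> X \<Longrightarrow> D w x = 1 \<Longrightarrow> rank T w \<le> Suc (rank T x)"
  using layer_step[OF layer_rank] rank_le by blast

lemma rank_predecessor:
  assumes "layer T k w" "rank T w = Suc (Suc l)"
  shows "\<exists>x\<in>X. D w x = 1 \<and> rank T x = Suc l \<and> (\<exists>k. layer T k x)"
  using layer_rank[OF assms(1)] unfolding assms(2)
proof cases
  case (layer_step x)
  then have "rank T x \<le> Suc l"
    by (auto intro: rank_le)
  moreover have "Suc (Suc l) \<le> Suc (rank T x)"
    using rank_le_Suc[of T "Suc l" x w] layer_step assms(2) by auto
  ultimately show ?thesis
    using layer_step layer_in_X by (intro bexI[of _ x]) auto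
qed auto

end

text \<open>Only local properties of a rank are kept, so that the mixed rank of the bypass argument
  fits as well as \<open>rank T\<close>. Numbering by nondecreasing \<rho> puts the vertices leading
  from \<open>w\<close> down to the path before \<open>w\<close>.\<close>

locale ranked_path = diametral_path +
  fixes T :: "nat set" and \<rho> :: "'a \<Rightarrow> nat" and f :: "'a \<Rightarrow> nat"
  assumes T_le: "j \<in> T \<Longrightarrow> j \<le> d"
    and \<rho>_pos: "w \<in> X \<Longrightarrow> 1 \<le> \<rho> w"
    and \<rho>_1: "w \<in> X \<Longrightarrow> \<rho> w = 1 \<Longrightarrow> \<exists>j\<in>T. D w (v j) = 1"
    and \<rho>_step: "w \<in> X \<Longrightarrow> \<rho> w = Suc (Suc k) \<Longrightarrow> \<exists>x\<in>X. D w x = 1 \<and> \<rho> x = Suc k"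
    and f_bij: "bij_betw f X {1..card X}"
    and f_mono: "x \<in> X \<Longrightarrow> y \<in> X \<Longrightarrow> \<rho> x < \<rho> y \<Longrightarrow> f x < f y"
begin

lemma f_inj: "x \<in> X \<Longrightarrow> y \<in> X \<Longrightarrow> f x = f y \<Longrightarrow> x = y"
  using f_bij by (auto simp: bij_betw_def inj_on_def)

lemma f_range: "x \<in> X \<Longrightarrow> 1 \<le> f x \<and> f x \<le> card X"
  using f_bij by (auto simp: bij_betw_def)

text \<open>Sets inside which one can descend to rank 1. Besides \<open>X\<close> itself, the two
  halves of the bypass argument are of this kind.\<close>

definition step_closed :: "'a set \<Rightarrow> bool" where
  "step_closed A \<longleftrightarrow> A \<subseteq> X \<and>
    (\<forall>w\<in>A. \<forall>k. \<rho> w = Suc (Suc k) \<longrightarrow> (\<exists>x\<in>A. D w x = 1 \<and> \<rho> x = Suc k))"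

lemma step_closedD:
  assumes "step_closed A"
  shows "w \<in> A \<Longrightarrow> w \<in> X"
    and "w \<in> A \<Longrightarrow> \<rho> w = Suc (Suc k) \<Longrightarrow> \<exists>x\<in>A. D w x = 1 \<and> \<rho> x = Suc k"
  using assms by (auto simp: step_closed_def)

lemma step_closed_X: "step_closed X"
  using \<rho>_step by (auto simp: step_closed_def)

lemma chain_vertex_in:
  assumes A: "step_closed A" and w: "w \<in> A" and "k < \<rho> w"
  shows "\<exists>x\<in>A. \<rho> x = \<rho> w - k \<and> D w x \<le> k"
  using assms(3)
proof (induction k)
  case 0
  then show ?case
    using w step_closedD(1)[OF A] X_not_P(1) D_eq_0_iff by (intro bexI[of _ w]) auto
next
  case (Suc k)
  then obtain x where x: "x \<in> A" "\<rho> x = \<rho> w - k" "D w x \<le> k"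
    by auto
  moreover obtain l where l: "\<rho> w - k = Suc (Suc l)"
    using Suc.prems by (metis Suc_diff_Suc Suc_lessD)
  ultimately obtain y where y: "y \<in> A" "D x y = 1" "\<rho> y = Suc l"
    using step_closedD(2)[OF A, of x l] by auto
  have "w \<in> V" "x \<in> V" "y \<in> V"
    using w x(1) y(1) step_closedD(1)[OF A] X_not_P(1) by auto
  then show ?case
    using D_triangle[of w x y] x(3) y l by (intro bexI[of _ y]) auto
qed

text \<open>Ranks fall by one along \<open>c\<close>, hence its vertices are distinct and, apart
  from \<open>w\<close>, numbered before \<open>w\<close>.\<close>

lemma chain_in_exists:
  assumes A: "step_closed A" and w: "w \<in> A"
  obtains c where "c 0 = w" "\<And>k. k < \<rho> w \<Longrightarrow> c k \<in> A"
    "\<And>k. k < \<rho> w \<Longrightarrow> \<rho> (c k) = \<rho> w - k" "\<And>k. k < \<rho> w \<Longrightarrow> D w (c k) \<le> k"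
    "inj_on c {..<\<rho> w}" "\<And>k. 0 < k \<Longrightarrow> k < \<rho> w \<Longrightarrow> f (c k) < f w"
proof -
  have wX: "w \<in> X"
    using step_closedD(1)[OF A] w by auto
  \<comment> \<open>The \<open>c k\<close> are chosen independently and consecutive ones need not be
    adjacent; only their distance to \<open>w\<close> matters.\<close>
  obtain c where c: "\<And>k. k < \<rho> w \<Longrightarrow> c k \<in> A \<and> \<rho> (c k) = \<rho> w - k \<and> D w (c k) \<le> k"
    using chain_vertex_in[OF A w] by metis
  have cX: "c k \<in> X" if "k < \<rho> w" for k
    using c[OF that] step_closedD(1)[OF A] by auto
  have "0 < \<rho> w"
    using \<rho>_pos[OF wX] by simp
  then have "D w (c 0) = 0" "c 0 \<in> X"
    using c[of 0] cX[of 0] by auto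
  then have "c 0 = w"
    using D_eq_0_iff[of w "c 0"] X_not_P(1) wX by auto
  moreover have "inj_on c {..<\<rho> w}"
  proof (rule inj_onI)
    fix k l assume kl: "k \<in> {..<\<rho> w}" "l \<in> {..<\<rho> w}" "c k = c l"
    then have "\<rho> w - k = \<rho> w - l"
      using c[of k] c[of l] by simp
    then show "k = l"
      using kl by auto
  qed
  moreover have "f (c k) < f w" if "0 < k" "k < \<rho> w" for k
    using c[of k] cX[of k] that wX by (intro f_mono) auto
  ultimately show ?thesis
    using c that by blast
qed

lemmas chain_vertex = chain_vertex_in[OF step_closed_X]

lemmas chain_exists = chain_in_exists[OF step_closed_X]

lemma attachment_exists:
  assumes "w \<in> X"
  shows "\<exists>j\<in>T. D w (v j) \<le> \<rho> w"
proof -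
  obtain x where x: "x \<in> X" "\<rho> x = 1" "D w x \<le> \<rho> w - 1"
    using chain_vertex[OF assms, of "\<rho> w - 1"] \<rho>_pos[OF assms] by auto
  obtain j where j: "j \<in> T" "D x (v j) = 1"
    using \<rho>_1 x by blast
  then show ?thesis
    using D_triangle[of w x "v j"] x X_not_P(1) v_in[OF T_le[OF j(1)]] assms \<rho>_pos[OF assms]
    by (intro bexI[of _ j]) auto
qed

text \<open>The chain starting at \<open>w\<close> has \<open>\<rho> w\<close> members, all with
  numbers in \<open>{1..f w}\<close>.\<close>

lemma rank_le_index:
  assumes "w \<in> X"
  shows "\<rho> w \<le> f w"
proof -
  obtain c where c: "c 0 = w" "\<And>k. k < \<rho> w \<Longrightarrow> c k \<in> X"
    "inj_on c {..<\<rho> w}" "\<And>k. 0 < k \<Longrightarrow> k < \<rho> w \<Longrightarrow> f (c k) < f w"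
    using chain_exists[OF assms] by metis
  have "inj_on f (c ` {..<\<rho> w})"
    using c(2) by (auto intro!: inj_onI f_inj)
  then have "inj_on (f \<circ> c) {..<\<rho> w}"
    using c(3) by (rule comp_inj_on[rotated])
  moreover have "(f \<circ> c) k \<in> {1..f w}" if "k < \<rho> w" for k
    using c f_range that by (cases "k = 0") (auto simp: Suc_le_eq less_imp_le)
  ultimately have "card {..<\<rho> w} \<le> card {1..f w}"
    by (intro card_inj_on_le[of "f \<circ> c"]) auto
  then show ?thesis
    by simp
qed

text \<open>Otherwise the chain members of rank above \<open>\<rho> x\<close> are all numbered after
  \<open>x\<close>, and there are \<open>f w - \<rho> x\<close> of them for only
  \<open>f w - f x\<close> numbers.\<close>

lemma tight_downward:
  assumes w: "w \<in> X" "\<rho> w = f w" and x: "x \<in> X" "f x \<le> f w"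
  shows "\<rho> x = f x"
proof (rule ccontr)
  assume "\<rho> x \<noteq> f x"
  then have lt: "\<rho> x < f x"
    using rank_le_index[OF x(1)] by simp
  obtain c where c: "c 0 = w" "\<And>k. k < \<rho> w \<Longrightarrow> c k \<in> X" "\<And>k. k < \<rho> w \<Longrightarrow> \<rho> (c k) = \<rho> w - k"
    "inj_on c {..<\<rho> w}" "\<And>k. 0 < k \<Longrightarrow> k < \<rho> w \<Longrightarrow> f (c k) < f w"
    using chain_exists[OF w(1)] by metis
  let ?K = "{..<\<rho> w - \<rho> x}"
  have K: "?K \<subseteq> {..<\<rho> w}"
    by auto
  have "inj_on f (c ` ?K)"
    using c(2) by (auto intro!: inj_onI f_inj)
  then have "inj_on (f \<circ> c) ?K"
    by (rule comp_inj_on[OF inj_on_subset[OF c(4) K]])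
  moreover have "(f \<circ> c) k \<in> {f x<..f w}" if "k \<in> ?K" for k
  proof -
    have "f x < f (c k)"
      using that c(2,3) x by (intro f_mono) auto
    then show ?thesis
      using c that by (cases "k = 0") (auto simp: less_imp_le)
  qed
  ultimately have "card ?K \<le> card {f x<..f w}"
    by (intro card_inj_on_le[of "f \<circ> c"]) auto
  then show False
    using lt x w by simp
qed

text \<open>Up to a tight vertex, rank and number agree, so ranks determine vertices and the chain
  member of rank \<open>f z\<close> can only be \<open>z\<close>.\<close>

lemma tight_distance:
  assumes w: "w \<in> X" "\<rho> w = f w" and z: "z \<in> X" "f z \<le> f w"
  shows "D w z \<le> f w - f z"
proof -
  have "f w - f z < \<rho> w"
    using w z f_range[of z] by auto
  then obtain x where x: "x \<in> X" "\<rho> x = \<rho> w - (f w - f z)" "D w x \<le> f w - f z"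
    using chain_vertex[OF w(1)] by blast
  have "\<rho> x = f z"
    using x w z by simp
  moreover have "\<rho> z = f z"
    using tight_downward w z by blast
  moreover have "f x \<le> f w"
  proof (rule ccontr)
    assume "\<not> f x \<le> f w"
    then have "\<rho> w \<le> \<rho> x"
      using f_mono[of x w] x w by (meson leI not_less_iff_gr_or_eq)
    then have "f z = f w"
      using \<open>\<rho> x = f z\<close> w z by simp
    then have "x = w"
      using x D_eq_0_iff[of w x] X_not_P(1) w by auto
    then show False
      using \<open>\<not> f x \<le> f w\<close> by simp
  qed
  ultimately have "f x = f z"
    using tight_downward[OF w x(1)] by simp
  then show ?thesis
    using x z f_inj by metis
qed

lemma ball_size_ge:
  assumes w: "w \<in> X" and Z: "Z \<subseteq> X" "\<And>z. z \<in> Z \<Longrightarrow> f z < f w \<and> D w z \<le> r"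
    and S: "\<And>i. i \<in> S \<Longrightarrow> i \<le> d \<and> D w (v i) \<le> r"
  shows "card Z + card S \<le> ball_size f r w"
proof -
  have "S \<subseteq> {..d}"
    using S by auto
  then have "card (v ` S) = card S"
    using inj_v by (auto intro: card_image inj_on_subset)
  moreover have "card (Z \<union> v ` S) = card Z + card (v ` S)"
    using Z S \<open>S \<subseteq> {..d}\<close> finite_subset[OF Z(1)] finite_subset[of S "{..d}"]
    by (intro card_Un_disjoint) (auto dest: X_not_P(2))
  moreover have "card (Z \<union> v ` S) \<le> ball_size f r w"
    unfolding ball_size_def using Z S by (intro card_mono) (auto simp: H_def)
  ultimately show ?thesis
    by simp
qed

text \<open>The chain contributes its members other than \<open>w\<close>, which is not in
  \<open>H f w\<close>; hence \<open>\<rho> w - 1\<close>.\<close>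

lemma ball_size_ge_chain:
  assumes w: "w \<in> X" and S: "\<And>i. i \<in> S \<Longrightarrow> i \<le> d \<and> D w (v i) \<le> r"
  shows "min r (\<rho> w - 1) + card S \<le> ball_size f r w"
proof -
  obtain c where c: "\<And>k. k < \<rho> w \<Longrightarrow> c k \<in> X" "\<And>k. k < \<rho> w \<Longrightarrow> D w (c k) \<le> k"
    "inj_on c {..<\<rho> w}" "\<And>k. 0 < k \<Longrightarrow> k < \<rho> w \<Longrightarrow> f (c k) < f w"
    using chain_exists[OF w] by metis
  let ?K = "{1..min r (\<rho> w - 1)}"
  have K: "0 < k \<and> k < \<rho> w \<and> k \<le> r" if "k \<in> ?K" for k
    using that by auto
  have "?K \<subseteq> {..<\<rho> w}"
    using K by auto
  then have "card (c ` ?K) = min r (\<rho> w - 1)"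
    using c(3) by (subst card_image) (auto intro: inj_on_subset)
  moreover have "card (c ` ?K) + card S \<le> ball_size f r w"
  proof (rule ball_size_ge[OF w _ _ S])
    show "c ` ?K \<subseteq> X"
      using c(1) K by blast
    fix z assume "z \<in> c ` ?K"
    then obtain k where "k \<in> ?K" "z = c k"
      by blast
    then show "f z < f w \<and> D w z \<le> r"
      using K[of k] c(2)[of k] c(4)[of k] by auto
  qed
  ultimately show ?thesis
    by simp
qed

text \<open>The chain accounts for \<open>\<rho> w - 1\<close> points. The remaining radius
  \<open>r - \<rho> w\<close> spreads along the path from \<open>v j\<close> and covers
  \<open>r - \<rho> w + a + 1\<close> more.\<close>

lemma ball_size_ge_attached:
  assumes w: "w \<in> X" and j: "j \<le> d" "D w (v j) \<le> \<rho> w"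
    and a: "a \<le> j" "a \<le> d - j" "a + \<rho> w \<le> r" "r + a \<le> d + \<rho> w"
  shows "r + a \<le> ball_size f r w"
proof -
  let ?S = "{i. i \<le> d \<and> (i - j) + (j - i) \<le> r - \<rho> w}"
  have "r - \<rho> w + a + 1 \<le> card ?S"
    using j a by (intro card_index_interval) auto
  moreover have "min r (\<rho> w - 1) + card ?S \<le> ball_size f r w"
  proof (rule ball_size_ge_chain[OF w])
    fix i assume i: "i \<in> ?S"
    then have "D w (v i) \<le> D w (v j) + D (v j) (v i)"
      using D_triangle v_in j X_not_P(1) w by auto
    then show "i \<le> d \<and> D w (v i) \<le> r"
      using i j a D_v[of j i] by auto
  qed
  ultimately show ?thesis
    using \<rho>_pos[OF w] a by auto
qed

text \<open>While \<open>r < \<rho> w\<close> the chain alone suffices, afterwards one direction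
  along the path does (\<open>a = 0\<close>). This discharges the hypothesis on balls in
  \<open>excess_le_gain\<close>.\<close>

lemma ball_size_ge_radius:
  assumes w: "w \<in> X" and r: "r \<le> d"
  shows "r \<le> ball_size f r w"
proof (cases "r < \<rho> w")
  case True
  then show ?thesis
    using ball_size_ge_chain[OF w, of "{}" r] by auto
next
  case False
  then show ?thesis
    using attachment_exists[OF w] T_le ball_size_ge_attached[OF w, of _ 0 r] r by auto
qed

lemma excess_le:
  "excess \<le> (\<Sum>i\<le>d. \<Sum>j\<le>d. int ((i - j) + (j - i))) - 2 * (\<Sum>i\<le>d. int (max i (d - i)))
    + 2 * (\<Sum>k\<in>{1..card X}. \<Sum>r<d. int (d + k) - 1 - int r) - 2 * (\<Sum>w\<in>X. int (gain f w))"
  using ball_size_ge_radius by (intro excess_le_gain f_bij) auto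

text \<open>The bound \<open>r + g r < d + f w\<close> keeps the claimed points within the
  truncation at \<open>card (H f w) - 1\<close>.\<close>

lemma sum_le_gain:
  assumes w: "w \<in> X"
    and g: "\<And>r. 1 \<le> r \<Longrightarrow> r < d \<Longrightarrow> r + g r \<le> ball_size f r w \<and> r + g r < d + f w"
  shows "sum g {1..<d} \<le> gain f w"
  unfolding gain_def card_H[OF f_bij w] using g by (intro sum_mono) fastforce

lemma card_le_gain:
  assumes w: "w \<in> X" and A: "A \<subseteq> {1..<d}" "\<And>r. r \<in> A \<Longrightarrow> r + 1 \<le> ball_size f r w"
  shows "card A \<le> gain f w"
proof -
  have "sum (\<lambda>r. if r \<in> A then 1 else 0) {1..<d} \<le> gain f w"
    using A f_range[OF w] ball_size_ge_radius[OF w] by (intro sum_le_gain[OF w]) auto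
  moreover have "{1..<d} \<inter> A = A"
    using A by auto
  ultimately show ?thesis
    by (simp add: sum.If_cases)
qed

end

section \<open>Vertices attached to the inner path\<close>

text \<open>The converse bounds tie \<rho> to the distance from the inner path: it is 1 next to an
  inner path vertex and drops by at most one along an edge between off-path vertices.\<close>

locale interior_ranked_path = ranked_path V D v d "{1..<d}" \<rho> f
  for V :: "'a set" and D v d \<rho> f +
  assumes d_ge_3: "3 \<le> d"
    and \<rho>_eq_1: "w \<in> X \<Longrightarrow> 1 \<le> j \<Longrightarrow> j < d \<Longrightarrow> D w (v j) = 1 \<Longrightarrow> \<rho> w = 1"
    and \<rho>_le_Suc: "w \<in> X \<Longrightarrow> x \<in> X \<Longrightarrow> D w x = 1 \<Longrightarrow> \<rho> w \<le> Suc (\<rho> x)"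
begin

text \<open>A vertex with \<open>\<rho> w < f w\<close> meets its quota by \<open>gain_ge_rank\<close>. Tight vertices, those with
  \<open>\<rho> w = f w \<ge> 2\<close>, form a single chain and may fall short by one each.\<close>

definition quota :: "nat \<Rightarrow> int" where
  "quota k = (if k = 1 then int d - 2 else int d - int k)"

lemma interior_attachment:
  assumes "w \<in> X"
  obtains j where "1 \<le> j" "j < d" "D w (v j) \<le> \<rho> w"
  using attachment_exists[OF assms] by auto

text \<open>An inner \<open>v j\<close> has a path neighbour on either side, so \<open>a = 1\<close>
  is available.\<close>

lemma ball_size_gt_radius:
  assumes w: "w \<in> X" and r: "\<rho> w < r" "r < d"
  shows "r + 1 \<le> ball_size f r w"
proof -
  obtain j where "1 \<le> j" "j < d" "D w (v j) \<le> \<rho> w"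
    using interior_attachment[OF w] .
  then show ?thesis
    using r by (intro ball_size_ge_attached[OF w, of j]) auto
qed

lemma gain_ge_rank:
  assumes w: "w \<in> X"
  shows "int d - 1 - int (\<rho> w) \<le> int (gain f w)"
proof -
  have "card {\<rho> w + 1..<d} \<le> gain f w"
    using ball_size_gt_radius[OF w] by (intro card_le_gain[OF w]) auto
  then show ?thesis
    by simp
qed

text \<open>One additional radius not above the rank lifts even a tight vertex to its quota.\<close>

lemma gain_ge_rank_extra:
  assumes w: "w \<in> X" and r: "1 \<le> r" "r \<le> \<rho> w" "r + 1 \<le> ball_size f r w"
  shows "int d - int (\<rho> w) \<le> int (gain f w)"
proof (cases "\<rho> w < d")
  case True
  then have "card (insert r {\<rho> w + 1..<d}) \<le> gain f w"
    using ball_size_gt_radius[OF w] r by (intro card_le_gain[OF w]) auto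
  then show ?thesis
    using r True by simp
qed simp

lemma quota_le_gain:
  assumes w: "w \<in> X" and "\<rho> w < f w \<or> f w = 1"
  shows "quota (f w) \<le> int (gain f w)"
  using assms gain_ge_rank[OF w] \<rho>_pos[OF w] rank_le_index[OF w] by (auto simp: quota_def)

lemma sum_quota: "(\<Sum>w\<in>X. quota (f w)) = (\<Sum>k\<in>{1..card X}. quota k)"
  by (rule sum.reindex_bij_betw[OF f_bij])

text \<open>Being next to an end, \<open>z\<close> gains at every radius, a surplus of
  \<open>f z - 1\<close> over its quota. This pays for the at most \<open>f z - 2\<close> vertices
  numbered from 2 to \<open>f z - 1\<close>. Later tight vertices gain an additional point by
  reaching the end through \<open>z\<close>.\<close>

lemma sum_gain_end_attached:
  assumes z: "z \<in> X" "2 \<le> \<rho> z" and t: "t \<in> {0, d}" "D z (v t) = 1"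
  shows "(\<Sum>w\<in>X. quota (f w)) \<le> (\<Sum>w\<in>X. int (gain f w))"
proof -
  have fz: "2 \<le> f z"
    using rank_le_index[OF z(1)] z by simp
  have td: "t \<le> d"
    using t by auto
  have gain_z: "quota (f z) + int (f z) - 1 \<le> int (gain f z)"
  proof -
    have "r + 1 \<le> ball_size f r z" if r: "1 \<le> r" "r < d" for r
    proof -
      \<comment> \<open>From the end the ball takes \<open>r\<close> path vertices, and the chain
        adds at least one more since \<open>\<rho> z \<ge> 2\<close>.\<close>
      let ?S = "{i. i \<le> d \<and> (i - t) + (t - i) \<le> r - 1}"
      have "r - 1 + 0 + 1 \<le> card ?S"
        using r td by (intro card_index_interval) auto
      moreover have "min r (\<rho> z - 1) + card ?S \<le> ball_size f r z"
      proof (rule ball_size_ge_chain[OF z(1)])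
        fix i assume i: "i \<in> ?S"
        then show "i \<le> d \<and> D z (v i) \<le> r"
          using D_triangle[of z "v t" "v i"] D_v[of t i] v_in td t X_not_P(1)[OF z(1)] r by auto
      qed
      ultimately show ?thesis
        using r z by auto
    qed
    then have "card {1..<d} \<le> gain f z"
      by (intro card_le_gain[OF z(1)]) auto
    then show ?thesis
      using d_ge_3 fz by (auto simp: quota_def)
  qed
  have gain_w: "quota (f w) \<le> int (gain f w)" if w: "w \<in> X" and fw: "f z < f w" for w
  proof (cases "\<rho> w < f w")
    case True
    then show ?thesis
      using quota_le_gain w by blast
  next
    case False
    then have tight: "\<rho> w = f w"
      using rank_le_index[OF w] by simp
    \<comment> \<open>The radius at which the ball around \<open>w\<close> reaches
      \<open>v t\<close> by way of \<open>z\<close>; it is below the rank of \<open>w\<close>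
      because \<open>f z \<ge> 2\<close>.\<close>
    define r where "r = f w - f z + 1"
    have "D w z \<le> f w - f z"
      using tight_distance[OF w tight z(1)] fw by simp
    then have "D w (v t) \<le> r"
      using D_triangle[of w z "v t"] t v_in[OF td] X_not_P(1) w z(1) by (auto simp: r_def)
    then have "min r (\<rho> w - 1) + card {t} \<le> ball_size f r w"
      using td by (intro ball_size_ge_chain[OF w]) auto
    then have "int d - int (\<rho> w) \<le> int (gain f w)"
      using fw fz tight by (intro gain_ge_rank_extra[OF w, of r]) (auto simp: r_def)
    then show ?thesis
      using tight fw fz by (auto simp: quota_def)
  qed
  let ?B = "{w \<in> X. 2 \<le> f w \<and> f w < f z}"
  have "quota (f w) - (if w \<in> ?B then 1 else 0) + (if w = z then int (f z) - 1 else 0)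
      \<le> int (gain f w)" if w: "w \<in> X" for w
  proof -
    consider "w = z" | "f z < f w" | "w \<in> ?B" | "f w = 1" "w \<noteq> z"
      using f_inj[OF w z(1)] f_range[OF w] w by fastforce
    then show ?thesis
    proof cases
      case 3
      then show ?thesis
        using gain_ge_rank[OF w] rank_le_index[OF w] by (auto simp: quota_def)
    next
      case 4
      then show ?thesis
        using quota_le_gain[OF w] by auto
    qed (use gain_z gain_w w in auto)
  qed
  then have "(\<Sum>w\<in>X. quota (f w) - (if w \<in> ?B then 1 else 0) + (if w = z then int (f z) - 1 else 0))
      \<le> (\<Sum>w\<in>X. int (gain f w))"
    by (intro sum_mono) auto
  moreover have "(\<Sum>w\<in>X. if w \<in> ?B then 1 else 0 :: int) = int (card ?B)"
    by (simp add: sum.If_cases Int_def)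
  moreover have "card ?B \<le> card {2..<f z}"
    using f_inj by (intro card_inj_on_le[of f]) (auto intro!: inj_onI)
  ultimately show ?thesis
    using fz z(1) by (simp add: sum.distrib sum_subtractf)
qed

text \<open>All other off-path vertices reach the path only through \<open>u\<close>. A second path
  neighbour of \<open>u\<close> gives every \<open>w\<close> an additional point at radius
  \<open>\<rho> w\<close>. With a single neighbour \<open>v j\<close>, maximality of
  \<open>d\<close> forces \<open>\<rho> w \<le> min j (d - j)\<close>, so the path is long on both
  sides of \<open>v j\<close>.\<close>

lemma sum_gain_cut_vertex:
  assumes u: "u \<in> X" "\<rho> u = 1" and unique: "\<And>x. x \<in> X \<Longrightarrow> \<rho> x = 1 \<Longrightarrow> x = u"
    and no_end: "\<And>z. z \<in> X \<Longrightarrow> 2 \<le> \<rho> z \<Longrightarrow> D z (v 0) \<noteq> 1 \<and> D z (v d) \<noteq> 1"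
    and card: "9 \<le> card V"
  shows "(\<Sum>w\<in>X. quota (f w)) \<le> (\<Sum>w\<in>X. int (gain f w))"
proof -
  have D_u: "D w u \<le> \<rho> w - 1" if w: "w \<in> X" for w
    using chain_vertex[OF w, of "\<rho> w - 1"] \<rho>_pos[OF w] unique by auto
  have uV: "u \<in> V"
    using u X_not_P by auto
  have detached: "D w (v i) \<noteq> 1" if "w \<in> X" "2 \<le> \<rho> w" "i \<le> d" for w i
    using no_end[OF that(1,2)] \<rho>_eq_1[OF that(1), of i] that
    by (cases "i = 0 \<or> i = d") auto
  have attached: "D w (v i) \<le> \<rho> w" if "w \<in> X" "i \<le> d" "D u (v i) = 1" for w i
    using D_triangle[of w u "v i"] D_u[OF that(1)] that \<rho>_pos[OF that(1)] uV v_in X_not_P(1) by auto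
  obtain j where j: "1 \<le> j" "j < d" "D u (v j) = 1"
    using \<rho>_1[OF u] by auto
  show ?thesis
  proof (cases "\<exists>i\<le>d. i \<noteq> j \<and> D u (v i) = 1")
    case True
    then obtain i where i: "i \<le> d" "i \<noteq> j" "D u (v i) = 1"
      by blast
    have "quota (f w) \<le> int (gain f w)" if w: "w \<in> X" for w
    proof -
      have "min (\<rho> w) (\<rho> w - 1) + card {i, j} \<le> ball_size f (\<rho> w) w"
        using attached[OF w] i j by (intro ball_size_ge_chain[OF w]) auto
      then have "int d - int (\<rho> w) \<le> int (gain f w)"
        using i \<rho>_pos[OF w] by (intro gain_ge_rank_extra[OF w, of "\<rho> w"]) auto
      then show ?thesis
        using rank_le_index[OF w] by (auto simp: quota_def)
    qed
    then show ?thesis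
      by (rule sum_mono)
  next
    case False
    \<comment> \<open>A shortest walk from \<open>w\<close> to the path stays off it until it meets
      \<open>u\<close>, since vertices of rank at least 2 have no path neighbour, and each step
      lowers the rank by at most one.\<close>
    have through_u: "\<rho> w - 1 + D u (v i) \<le> D w (v i)" if wX: "w \<in> X" and i: "i \<le> d" for w i
      using wX
    proof (induction "D w (v i)" arbitrary: w)
      case 0
      then show ?case
        using D_eq_0_iff[of w "v i"] v_in[OF i] X_not_P i by auto
    next
      case (Suc k)
      show ?case
      proof (cases "\<rho> w = 1")
        case True
        then show ?thesis
          using unique Suc by auto
      next
        case False
        then have rk: "2 \<le> \<rho> w"
          using \<rho>_pos[OF Suc.prems] by simp
        obtain z where z: "z \<in> V" "D w z = 1" "D z (v i) = k"
          using D_step[OF X_not_P(1)[OF Suc.prems] v_in[OF i], of k] Suc.hyps(2) by auto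
        have "z \<in> X"
          using z(1) by (cases rule: V_cases) (use z(2) detached[OF Suc.prems rk] in auto)
        then show ?thesis
          using Suc.hyps(1)[of z] z Suc.hyps(2) \<rho>_le_Suc[OF Suc.prems _ z(2)] rk \<rho>_pos[of z]
          by fastforce
      qed
    qed
    \<comment> \<open>The first step of a shortest walk from \<open>u\<close> leads to
      \<open>v j\<close>; a step to an off-path vertex would have to return through
      \<open>u\<close>.\<close>
    have D_u_v: "1 + ((i - j) + (j - i)) \<le> D u (v i)" if i: "i \<le> d" for i
    proof -
      have "D u (v i) \<noteq> 0"
        using D_eq_0_iff[of u "v i"] v_in X_not_P u i by auto
      then obtain k where k: "D u (v i) = Suc k"
        using not0_implies_Suc by blast
      then obtain z where z: "z \<in> V" "D u z = 1" "D z (v i) = k"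
        using D_step[of u "v i" k] uV v_in i by auto
      from z(1) show ?thesis
      proof (cases rule: V_cases)
        case (path i')
        then have "i' = j"
          using False z(2) by auto
        then show ?thesis
          using z k D_v[of j i] j i path by auto
      next
        case off
        then have "\<rho> z \<noteq> 1"
          using unique z(2) D_eq_0_iff[OF uV uV] by auto
        then have "2 \<le> \<rho> z"
          using \<rho>_pos[OF off] by simp
        then show ?thesis
          using through_u[OF off i] z k by auto
      qed
    qed
    have rank_bound: "\<rho> w \<le> j" "\<rho> w \<le> d - j" if w: "w \<in> X" for w
      using through_u[OF w, of 0] through_u[OF w, of d] D_u_v[of 0] D_u_v[of d] j
        D_le[of w "v 0"] D_le[of w "v d"] v_in X_not_P(1)[OF w] \<rho>_pos[OF w] by auto
    show ?thesis
    proof (cases "d = 4")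
      case True
      then have rank_2: "\<rho> w \<le> 2" if "w \<in> X" for w
        using rank_bound[OF that] by linarith
      have d4: "int d = 4"
        using True by simp
      \<comment> \<open>Order 9 guarantees a vertex numbered 4. Its rank is at most 2, so it exceeds
        its quota by one, which covers the possible deficit of the vertex numbered 2.\<close>
      have "4 \<le> card X"
        using card card_V True by simp
      then have "2 \<in> f ` X" "4 \<in> f ` X"
        using f_bij by (auto simp: bij_betw_def)
      then obtain w2 w4 where w24: "w2 \<in> X" "f w2 = 2" "w4 \<in> X" "f w4 = 4"
        by (metis imageE)
      have "quota (f w) - (if w = w2 then 1 else 0) + (if w = w4 then 1 else 0) \<le> int (gain f w)"
        if w: "w \<in> X" for w
      proof -
        have q: "quota (f w) = (if f w = 1 then 2 else 4 - int (f w))"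
          unfolding quota_def d4 by simp
        have g: "3 - int (\<rho> w) \<le> int (gain f w)"
          using gain_ge_rank[OF w] unfolding d4 by simp
        have r: "\<rho> w \<le> 2" "\<rho> w \<le> f w" "1 \<le> f w"
          using rank_2[OF w] rank_le_index[OF w] f_range[OF w] by auto
        have "w2 \<noteq> w4"
          using w24(2,4) by auto
        then consider "w = w2" "w \<noteq> w4" | "w = w4" "w \<noteq> w2" | "w \<noteq> w2" "w \<noteq> w4"
          by blast
        then show ?thesis
        proof cases
          case 3
          have "f w \<noteq> f w2"
            using f_inj[OF w w24(1)] 3 by blast
          then show ?thesis
            using q g r 3 w24(2) by (simp split: if_splits)
        qed (use q g r w24(2,4) in \<open>simp_all split: if_splits\<close>)
      qed
      then have "(\<Sum>w\<in>X. quota (f w) - (if w = w2 then 1 else 0) + (if w = w4 then 1 else 0))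
          \<le> (\<Sum>w\<in>X. int (gain f w))"
        by (rule sum_mono)
      then show ?thesis
        using w24 by (simp add: sum.distrib sum_subtractf)
    next
      case False
      have "quota (f w) \<le> int (gain f w)" if w: "w \<in> X" for w
      proof (cases "\<rho> w < f w \<or> f w = 1")
        case True
        then show ?thesis
          using quota_le_gain[OF w] by blast
      next
        case ntight: False
        let ?l = "\<rho> w"
        have l: "?l = f w" "2 \<le> ?l"
          using ntight rank_le_index[OF w] f_range[OF w] by auto
        then have ld: "?l + 3 \<le> d"
          using rank_bound[OF w] j False by linarith
        \<comment> \<open>Radius \<open>d - 1\<close> gains two points, as the path extends at least
          two steps to each side of \<open>v j\<close>; this makes up for radius
          \<open>\<rho> w\<close>, at which no gain is claimed.\<close>
        let ?g = "\<lambda>r. (if ?l < r then 1 else 0) + (if r = d - 1 then 1 else 0 :: nat)"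
        have "r + ?g r \<le> ball_size f r w \<and> r + ?g r < d + f w" if r: "1 \<le> r" "r < d" for r
        proof (cases "r = d - 1")
          case True
          have "D w (v j) \<le> \<rho> w"
            using attached[OF w] j by simp
          then have "r + 2 \<le> ball_size f r w"
            using rank_bound[OF w] l ld True r j by (intro ball_size_ge_attached[OF w, of j]) auto
          then show ?thesis
            using True l ld by auto
        next
          case False
          then show ?thesis
            using r l ball_size_gt_radius[OF w, of r] ball_size_ge_radius[OF w, of r] by auto
        qed
        then have "sum ?g {1..<d} \<le> gain f w"
          by (intro sum_le_gain[OF w])
        moreover have "{1..<d} \<inter> {r. ?l < r} = {?l + 1..<d}"
          by auto
        ultimately have "d - (?l + 1) + 1 \<le> gain f w"
          using ld by (simp add: sum.distrib sum.If_cases split: if_splits)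
        then show ?thesis
          using l ld by (simp add: quota_def)
      qed
      then show ?thesis
        by (rule sum_mono)
    qed
  qed
qed

text \<open>Without tight vertices beyond number 1 every vertex meets its quota. A tight one forces
  the vertex numbered 2 to have rank 2, so only number 1 has rank 1, and one of the two preceding
  lemmas applies.\<close>

lemma sum_gain_ge_quota:
  assumes "9 \<le> card V"
  shows "(\<Sum>k\<in>{1..card X}. quota k) \<le> (\<Sum>w\<in>X. int (gain f w))"
  unfolding sum_quota[symmetric]
proof (cases "\<exists>w\<in>X. 2 \<le> f w \<and> \<rho> w = f w")
  case False
  then have "\<rho> w < f w \<or> f w = 1" if "w \<in> X" for w
    using that rank_le_index[OF that] f_range[OF that] by fastforce
  then show "(\<Sum>w\<in>X. quota (f w)) \<le> (\<Sum>w\<in>X. int (gain f w))"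
    using quota_le_gain by (intro sum_mono) blast
next
  case True
  then obtain w where w: "w \<in> X" "2 \<le> f w" "\<rho> w = f w"
    by blast
  have "f ` X = {1..card X}"
    using f_bij by (auto simp: bij_betw_def)
  moreover have "2 \<in> {1..card X}" "1 \<in> {1..card X}"
    using f_range[OF w(1)] w by auto
  ultimately obtain w2 u where w2: "w2 \<in> X" "f w2 = 2" and u: "u \<in> X" "f u = 1"
    by (metis imageE)
  have r2: "\<rho> w2 = 2" and ru: "\<rho> u = 1"
    using tight_downward[OF w(1,3)] w w2 u by auto
  have unique: "x = u" if "x \<in> X" "\<rho> x = 1" for x
    using f_mono[OF that(1) w2(1)] that r2 w2 f_range[OF that(1)] f_inj[OF that(1) u(1)] u by auto
  show "(\<Sum>w\<in>X. quota (f w)) \<le> (\<Sum>w\<in>X. int (gain f w))"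
  proof (cases "\<exists>z\<in>X. 2 \<le> \<rho> z \<and> (D z (v 0) = 1 \<or> D z (v d) = 1)")
    case True
    then show ?thesis
      using sum_gain_end_attached by auto
  next
    case False
    then show ?thesis
      using sum_gain_cut_vertex[OF u(1) ru unique _ assms] by auto
  qed
qed

end

section \<open>Chains bypassing the inner path\<close>

context ranked_path
begin

text \<open>The edge between \<open>x\<close> and \<open>y\<close> joins two disjoint chains leading
  to the two ends of the path. From \<open>y\<close> one can descend its own chain or pass to
  \<open>x\<close> and descend the other, continuing along the path; each direction gives
  \<open>r\<close> points, so the ball has \<open>2 * r\<close>.\<close>

lemma gain_between_chains:
  assumes t: "t \<in> {0, d}"
    and A: "step_closed A" "\<And>w. w \<in> A \<Longrightarrow> \<rho> w = D w (v t)"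
    and B: "step_closed B" "\<And>w. w \<in> B \<Longrightarrow> \<rho> w = D w (v (d - t))"
    and disjoint: "A \<inter> B = {}"
    and xy: "x \<in> A" "y \<in> B" "D y x = 1" "f x < f y"
  shows "d - 1 \<le> card X" "(\<Sum>r\<in>{1..<d}. r) \<le> gain f y"
proof -
  let ?\<alpha> = "\<rho> x" and ?\<beta> = "\<rho> y"
  have X: "x \<in> X" "y \<in> X" and V: "x \<in> V" "y \<in> V"
    using xy step_closedD(1)[OF A(1)] step_closedD(1)[OF B(1)] X_not_P(1) by auto
  have td: "t \<le> d" "d - t \<le> d" "v t \<in> V" "v (d - t) \<in> V"
    using t v_in by auto
  have "d = D (v t) (v (d - t))"
    using D_v[of t "d - t"] t by auto
  also have "\<dots> \<le> D (v t) x + (D x y + D y (v (d - t)))"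
    using D_triangle[of "v t" x "v (d - t)"] D_triangle[of x y "v (d - t)"] V td by linarith
  \<comment> \<open>The two chains and the edge between them connect the ends, which are at distance
    \<open>d\<close>.\<close>
  finally have ab: "d \<le> ?\<alpha> + ?\<beta> + 1"
    using A(2)[OF xy(1)] B(2)[OF xy(2)] D_sym[of "v t" x] D_sym[of x y] V td xy(3) by simp
  obtain a where a: "a 0 = x" "\<And>k. k < ?\<alpha> \<Longrightarrow> a k \<in> A" "\<And>k. k < ?\<alpha> \<Longrightarrow> D x (a k) \<le> k"
    "inj_on a {..<?\<alpha>}" "\<And>k. 0 < k \<Longrightarrow> k < ?\<alpha> \<Longrightarrow> f (a k) < f x"
    using chain_in_exists[OF A(1) xy(1)] by metis
  obtain b where b: "b 0 = y" "\<And>k. k < ?\<beta> \<Longrightarrow> b k \<in> B" "\<And>k. k < ?\<beta> \<Longrightarrow> D y (b k) \<le> k"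
    "inj_on b {..<?\<beta>}" "\<And>k. 0 < k \<Longrightarrow> k < ?\<beta> \<Longrightarrow> f (b k) < f y"
    using chain_in_exists[OF B(1) xy(2)] by metis
  have fa: "f (a k) < f y" if "k < ?\<alpha>" for k
    using a(1) a(5)[of k] that xy(4) by (cases "k = 0") auto
  have fb: "f (b k) \<le> f y" if "k < ?\<beta>" for k
    using b(1) b(5)[of k] that by (cases "k = 0") auto
  have aX: "a k \<in> X" if "k < ?\<alpha>" for k
    using a(2)[OF that] step_closedD(1)[OF A(1)] by auto
  have Da: "D y (a k) \<le> Suc k" if "k < ?\<alpha>" for k
    using D_triangle[of y x "a k"] a(3)[OF that] X_not_P(1)[OF aX[OF that]] V xy(3) by auto
  have bX: "b k \<in> X" if "k < ?\<beta>" for k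
    using b(2)[OF that] step_closedD(1)[OF B(1)] by auto
  have card_ab: "card (a ` I \<union> b ` J) = card I + card J"
    if "I \<subseteq> {..<?\<alpha>}" "J \<subseteq> {..<?\<beta>}" for I J
  proof -
    have "a ` I \<subseteq> A" "b ` J \<subseteq> B"
      using a(2) b(2) that by blast+
    then have "a ` I \<inter> b ` J = {}"
      using disjoint by blast
    then have "card (a ` I \<union> b ` J) = card (a ` I) + card (b ` J)"
      using finite_subset[OF that(1)] finite_subset[OF that(2)] by (intro card_Un_disjoint) auto
    then show ?thesis
      using card_image[OF inj_on_subset[OF a(4) that(1)]] card_image[OF inj_on_subset[OF b(4) that(2)]]
      by simp
  qed
  have ab_fy: "?\<alpha> + ?\<beta> \<le> f y"
  proof -
    let ?Z = "a ` {..<?\<alpha>} \<union> b ` {..<?\<beta>}"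
    have Z: "z \<in> X \<and> f z \<le> f y" if "z \<in> ?Z" for z
      using that aX bX fa fb by (auto intro: less_imp_le)
    have "card ?Z \<le> card {1..f y}"
      using Z f_range by (intro card_inj_on_le[of f]) (auto intro!: inj_onI f_inj)
    then show ?thesis
      using card_ab[of "{..<?\<alpha>}" "{..<?\<beta>}"] by simp
  qed
  then show "d - 1 \<le> card X"
    using ab f_range[OF X(2)] by auto
  have pos: "1 \<le> ?\<alpha>" "1 \<le> ?\<beta>"
    using \<rho>_pos X by auto
  show "(\<Sum>r\<in>{1..<d}. r) \<le> gain f y"
  proof (rule sum_le_gain[OF X(2)])
    fix r assume r: "1 \<le> r" "r < d"
    \<comment> \<open>Towards \<open>x\<close> the ball takes \<open>min r (\<rho> x)\<close> chain
      members and \<open>r - \<rho> x\<close> path vertices, the other way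
      \<open>min r (\<rho> y - 1)\<close> and \<open>r + 1 - \<rho> y\<close>; either pair adds up
      to \<open>r\<close>. The indices of \<open>b\<close> start at 1 because \<open>y\<close>
      itself does not count.\<close>
    let ?Z = "a ` {..<min r ?\<alpha>} \<union> b ` {1..min r (?\<beta> - 1)}"
    let ?S1 = "{i. i \<le> d \<and> (i - t) + (t - i) + 1 + ?\<alpha> \<le> r}"
    let ?S2 = "{i. i \<le> d \<and> (i - (d - t)) + ((d - t) - i) + ?\<beta> \<le> r}"
    have "{..<min r ?\<alpha>} \<subseteq> {..<?\<alpha>}" "{1..min r (?\<beta> - 1)} \<subseteq> {..<?\<beta>}"
      using pos by auto
    from card_ab[OF this] have cZ: "card ?Z = min r ?\<alpha> + min r (?\<beta> - 1)"
      by simp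
    have cS1: "r - ?\<alpha> \<le> card ?S1"
    proof (cases "?\<alpha> < r")
      case True
      then have eq: "?S1 = {i. i \<le> d \<and> (i - t) + (t - i) \<le> r - 1 - ?\<alpha>}"
        by auto
      have "r - 1 - ?\<alpha> + 0 + 1 \<le> card ?S1"
        unfolding eq using r td by (intro card_index_interval) auto
      then show ?thesis
        using True by linarith
    qed simp
    have cS2: "r + 1 - ?\<beta> \<le> card ?S2"
    proof (cases "?\<beta> \<le> r")
      case True
      then have eq: "?S2 = {i. i \<le> d \<and> (i - (d - t)) + ((d - t) - i) \<le> r - ?\<beta>}"
        by auto
      have "r - ?\<beta> + 0 + 1 \<le> card ?S2"
        unfolding eq using r td by (intro card_index_interval) auto
      then show ?thesis
        using True by linarith
    qed simp
    \<comment> \<open>A common index would need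
      \<open>d + 1 + \<rho> x + \<rho> y \<le> 2 * r\<close>, against \<open>ab\<close> and
      \<open>r < d\<close>.\<close>
    have "?S1 \<inter> ?S2 = {}"
      using t ab r by auto
    then have cS: "card (?S1 \<union> ?S2) = card ?S1 + card ?S2"
      by (intro card_Un_disjoint) auto
    have "card ?Z + card (?S1 \<union> ?S2) \<le> ball_size f r y"
    proof (rule ball_size_ge[OF X(2)])
      show "?Z \<subseteq> X"
        using aX bX pos by auto
      fix z assume "z \<in> ?Z"
      then show "f z < f y \<and> D y z \<le> r"
      proof
        assume "z \<in> a ` {..<min r ?\<alpha>}"
        then obtain k where "k < r" "k < ?\<alpha>" "z = a k"
          by auto
        then show ?thesis
          using fa[of k] Da[of k] by auto
      next
        assume "z \<in> b ` {1..min r (?\<beta> - 1)}"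
        then obtain k where k: "0 < k" "k \<le> r" "k \<le> ?\<beta> - 1" "z = b k"
          by (auto simp: Suc_le_eq)
        then have "k < ?\<beta>"
          using pos by linarith
        then show ?thesis
          using b(3)[of k] b(5)[of k] k by auto
      qed
    next
      fix i assume i: "i \<in> ?S1 \<union> ?S2"
      then have id: "i \<le> d" "v i \<in> V"
        using v_in by auto
      have "D y (v i) \<le> 1 + ?\<alpha> + D (v t) (v i)"
        using D_triangle[of y x "v i"] D_triangle[of x "v t" "v i"] A(2)[OF xy(1)] V td id xy(3)
        by linarith
      moreover have "D y (v i) \<le> ?\<beta> + D (v (d - t)) (v i)"
        using D_triangle[of y "v (d - t)" "v i"] B(2)[OF xy(2)] V td id by linarith
      ultimately show "i \<le> d \<and> D y (v i) \<le> r"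
        using i id D_v[of t i] D_v[of "d - t" i] td by auto
    qed
    moreover have "min r ?\<alpha> + (r - ?\<alpha>) = r" "min r (?\<beta> - 1) + (r + 1 - ?\<beta>) = r"
      using pos by auto
    ultimately have "r + r \<le> ball_size f r y"
      using cZ cS cS1 cS2 by linarith
    then show "r + r \<le> ball_size f r y \<and> r + r < d + f y"
      using ab ab_fy r by linarith
  qed
qed

end

section \<open>The extremal metric\<close>

text \<open>Over ordered pairs: twice the Wiener index of a path on \<open>k\<close> vertices, that
  is \<open>2 * (k + 1 choose 3)\<close>.\<close>

definition path_distance_sum :: "nat \<Rightarrow> int" where
  "path_distance_sum k = (\<Sum>i<k. \<Sum>j<k. int ((i - j) + (j - i)))"

definition path_ecc_sum :: "nat \<Rightarrow> int" where
  "path_ecc_sum k = (\<Sum>i<k. int (max i (k - 1 - i)))"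

lemma path_distance_sum_eq: "3 * path_distance_sum k = (int k - 1) * int k * (int k + 1)"
proof (induction k)
  case (Suc k)
  have "2 * (\<Sum>i<k. int i) = int k * (int k - 1)"
    by (induction k) (auto simp: algebra_simps)
  moreover have "(\<Sum>i<k. int (k - i)) = (\<Sum>i<k. int k - int i)"
    by (rule sum.cong) auto
  ultimately have col: "2 * (\<Sum>i<k. int (k - i)) = int k * (int k + 1)"
    by (simp add: sum_subtractf algebra_simps)
  have c: "(\<Sum>j<k. int ((k - j) + (j - k))) = (\<Sum>i<k. int (k - i))"
    "(\<Sum>i<k. int ((i - k) + (k - i))) = (\<Sum>i<k. int (k - i))"
    by (auto intro!: sum.cong)
  have "path_distance_sum (Suc k) = path_distance_sum k + 2 * (\<Sum>i<k. int (k - i))"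
    unfolding path_distance_sum_def using c by (simp add: sum.distrib)
  then show ?case
    using Suc col by (simp add: algebra_simps)
qed (simp add: path_distance_sum_def)

text \<open>Deleting both end vertices lowers every remaining eccentricity by one, hence the
  induction in steps of two. The slack of 1 absorbs the dependence on the parity of
  \<open>k\<close>.\<close>

lemma path_ecc_sum_bounds:
  "3 * int k * int k - 2 * int k - 1 \<le> 4 * path_ecc_sum k"
  "4 * path_ecc_sum k \<le> 3 * int k * int k - 2 * int k"
proof -
  have step: "path_ecc_sum (Suc (Suc k)) = path_ecc_sum k + 3 * int k + 2" for k
  proof -
    have "path_ecc_sum (Suc (Suc k))
        = (\<Sum>i<k. int (max (Suc i) (k - i))) + int (k + 1) + int (k + 1)"
      unfolding path_ecc_sum_def by (subst sum.lessThan_Suc_shift) (simp add: max_def)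
    also have "(\<Sum>i<k. int (max (Suc i) (k - i))) = (\<Sum>i<k. int (max i (k - 1 - i)) + 1)"
      by (rule sum.cong) auto
    also have "\<dots> = path_ecc_sum k + int k"
      by (simp add: path_ecc_sum_def sum.distrib)
    finally show ?thesis
      by simp
  qed
  have "3 * int k * int k - 2 * int k - 1 \<le> 4 * path_ecc_sum k \<and>
    4 * path_ecc_sum k \<le> 3 * int k * int k - 2 * int k"
  proof (induction k rule: nat_less_induct)
    case (1 n)
    consider "n = 0" | "n = 1" | k where "n = Suc (Suc k)"
      by (metis One_nat_def not0_implies_Suc)
    then show ?case
    proof cases
      case 3
      then show ?thesis
        using 1 step[of k] by (auto simp: algebra_simps dest!: spec[of _ k])
    qed (auto simp: path_ecc_sum_def)
  qed
  then show "3 * int k * int k - 2 * int k - 1 \<le> 4 * path_ecc_sum k"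
    "4 * path_ecc_sum k \<le> 3 * int k * int k - 2 * int k"
    by auto
qed

section \<open>Reduction to polynomial inequalities\<close>

lemma off_path_sum_eq:
  "2 * (\<Sum>k\<in>{1..m}. \<Sum>r<d. int (d + k) - 1 - int r) = int m * int d * int (d + m)"
proof -
  have inner: "2 * (\<Sum>r<d. c - 1 - int r) = 2 * int d * (c - 1) - int d * (int d - 1)" for c
    by (induction d) (auto simp: algebra_simps)
  show ?thesis
  proof (induction m)
    case (Suc m)
    then show ?case
      using inner[of "int (d + Suc m)"] by (simp add: algebra_simps)
  qed simp
qed

text \<open>Multiplication by 6 clears the denominators of the closed forms; the summand 3 in the
  hypothesis is three times the slack in the lower bound of
  \<open>path_ecc_sum_bounds\<close>.\<close>

lemma path_value_gt:
  assumes "6 * (int d * int m) + 8 * int m + 3 * int m ^ 2 + 3 < 2 * int m ^ 3 + 12 * \<Gamma>"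
  shows "path_distance_sum (d + 1) - 2 * path_ecc_sum (d + 1)
      + 2 * (\<Sum>k\<in>{1..m}. \<Sum>r<d. int (d + k) - 1 - int r) - 2 * \<Gamma>
    < path_distance_sum (d + 1 + m) - 2 * path_ecc_sum (d + 1 + m)"
  using assms path_distance_sum_eq[of "d + 1"] path_distance_sum_eq[of "d + 1 + m"]
    path_ecc_sum_bounds(1)[of "d + 1"] path_ecc_sum_bounds(2)[of "d + 1 + m"]
    off_path_sum_eq[of d m]
  by (simp add: algebra_simps power2_eq_square power3_eq_cube)

lemma power_int_mono_bounds:
  fixes m c :: int
  assumes "c \<le> m" "0 \<le> m"
  shows "c * m \<le> m ^ 2" "c * m ^ 2 \<le> m ^ 3"
  using assms mult_right_mono[of c m m] mult_right_mono[of c m "m ^ 2"]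
  by (auto simp: power2_eq_square power3_eq_cube mult.assoc)

lemma crude_inequality:
  fixes d m :: int
  assumes "d \<le> 2" "8 \<le> d + m"
  shows "6 * (d * m) + 8 * m + 3 * m ^ 2 + 3 < 2 * m ^ 3"
proof -
  have m: "6 \<le> m"
    using assms by simp
  have "d * m \<le> 2 * m"
    using assms m by (intro mult_right_mono) auto
  then show ?thesis
    using m power_int_mono_bounds[of 6 m] by linarith
qed

text \<open>The hypothesis of \<open>path_value_gt\<close> with the sum of the quotas as
  \<Gamma>.\<close>

lemma interior_inequality:
  fixes d m :: int
  assumes "3 \<le> d" "1 \<le> m" "8 \<le> d + m"
  shows "14 * m + 9 * m ^ 2 + 15 < 2 * m ^ 3 + 6 * (d * m)"
proof (cases "6 \<le> m")
  case True
  have "3 * m \<le> d * m"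
    using assms by (intro mult_right_mono) auto
  then show ?thesis
    using True power_int_mono_bounds[of 6 m] by linarith
next
  case False
  then have "m \<in> {1, 2, 3, 4, 5}"
    using assms by auto
  then show ?thesis
    using assms by auto
qed

text \<open>The hypothesis of \<open>path_value_gt\<close> with \<open>d * (d - 1) / 2\<close> as
  \<Gamma>, the gain of the vertex closing the cycle.\<close>

lemma cycle_inequality:
  fixes d m :: int
  assumes "d - 1 \<le> m" "8 \<le> d + m"
  shows "6 * (d * m) + 8 * m + 3 * m ^ 2 + 6 * d + 3 < 2 * m ^ 3 + 6 * (d * d)"
proof (cases "5 \<le> m")
  case True
  \<comment> \<open>For fixed \<open>m\<close> the quadratic \<open>d * d - d * m - d\<close> is
    least at \<open>2 * d = m + 1\<close>; the square expresses this lower bound.\<close>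
  have "0 \<le> (2 * d - m - 1) * (2 * d - m - 1)"
    by simp
  then have "4 * (d * m) + 4 * d \<le> 4 * (d * d) + m ^ 2 + 1 + 2 * m"
    by (simp add: power2_eq_square algebra_simps)
  then show ?thesis
    using True power_int_mono_bounds[of 5 m] by linarith
next
  case False
  then have "m = 4" "d = 4 \<or> d = 5"
    using assms by auto
  then show ?thesis
    by auto
qed

context interior_ranked_path
begin

lemma sum_quota_eq:
  "1 \<le> m \<Longrightarrow> 2 * (\<Sum>k\<in>{1..m}. quota k) = 2 * int m * (int d - 1) - 2 - int m * (int m - 1)"
proof (induction m rule: nat_induct_at_least)
  case base
  then show ?case
    by (simp add: quota_def)
next
  case (Suc m)
  then have "quota (Suc m) = int d - int (Suc m)"
    by (simp add: quota_def)
  then show ?case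
    using Suc by (simp add: algebra_simps)
qed

end

section \<open>Existence of rankings and comparison with the path\<close>

context diametral_path
begin

lemma exists_ranked_path_rank:
  assumes T: "\<And>j. j \<in> T \<Longrightarrow> j \<le> d" and layered: "\<And>w. w \<in> X \<Longrightarrow> \<exists>k. layer T k w"
  shows "\<exists>f. ranked_path V D v d T (rank T) f"
proof -
  obtain f where f: "bij_betw f X {1..card X}" "\<forall>x\<in>X. \<forall>y\<in>X. rank T x < rank T y \<longrightarrow> f x < f y"
    using exists_rank_enumeration[of X "rank T"] by auto
  have "ranked_path V D v d T (rank T) f"
  proof
    fix w assume w: "w \<in> X"
    obtain k where k: "layer T k w"
      using layered[OF w] by blast
    show "1 \<le> rank T w"
      by (rule rank_ge_1[OF k])
    show "rank T w = 1 \<Longrightarrow> \<exists>j\<in>T. D w (v j) = 1"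
      by (rule rank_1_attached[OF k])
    show "rank T w = Suc (Suc l) \<Longrightarrow> \<exists>x\<in>X. D w x = 1 \<and> rank T x = Suc l" for l
      using rank_predecessor[OF k] by blast
  qed (use f T in auto)
  then show ?thesis
    by blast
qed

lemma exists_ranked_path: "\<exists>\<rho> f. ranked_path V D v d {..d} \<rho> f"
proof -
  have "\<exists>k. layer {..d} k w" if "w \<in> X" for w
    using that
  proof (induction "D w (v 0)" arbitrary: w)
    case 0
    then show ?case
      using D_eq_0_iff[of w "v 0"] v_in X_not_P by auto
  next
    case (Suc n)
    obtain z where z: "z \<in> V" "D w z = 1" "D z (v 0) = n"
      using D_step[OF X_not_P(1)[OF Suc.prems] v_in[of 0], of n] Suc.hyps(2) by auto
    from z(1) show ?case
    proof (cases rule: V_cases)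
      case (path i)
      then show ?thesis
        using layer_base[of w i "{..d}"] Suc.prems z(2) by auto
    next
      case off
      then show ?thesis
        using Suc.hyps(1)[of z] z Suc.prems layer_step by blast
    qed
  qed
  then have "\<exists>f. ranked_path V D v d {..d} (rank {..d}) f"
    by (intro exists_ranked_path_rank) auto
  then show ?thesis
    by blast
qed

lemma exists_interior_ranked_path:
  assumes d: "3 \<le> d" and layered: "\<And>w. w \<in> X \<Longrightarrow> \<exists>k. layer {1..<d} k w"
  shows "\<exists>\<rho> f. interior_ranked_path V D v d \<rho> f"
proof -
  have "\<exists>f. ranked_path V D v d {1..<d} (rank {1..<d}) f"
    using layered by (intro exists_ranked_path_rank) auto
  then obtain f where "ranked_path V D v d {1..<d} (rank {1..<d}) f"
    by blast
  moreover have "interior_ranked_path_axioms V D v d (rank {1..<d})"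
  proof
    fix w assume w: "w \<in> X"
    show "1 \<le> j \<Longrightarrow> j < d \<Longrightarrow> D w (v j) = 1 \<Longrightarrow> rank {1..<d} w = 1" for j
      using rank_eq_1[OF w, of j] by auto
    show "x \<in> X \<Longrightarrow> D w x = 1 \<Longrightarrow> rank {1..<d} w \<le> Suc (rank {1..<d} x)" for x
      using rank_le_Suc[OF _ w] layered[of x] by blast
  qed (rule d)
  ultimately show ?thesis
    using interior_ranked_path.intro by blast
qed

text \<open>The off-path vertices cut off from the inner path form \<open>K\<close>, whose only
  neighbours outside \<open>K\<close> are the two ends. \<open>K\<close> is split according to the
  nearer end, and an edge between the halves sets up \<open>gain_between_chains\<close>.\<close>

lemma exists_ranked_path_bypass:
  assumes d: "3 \<le> d" and w0: "w0 \<in> X" "\<nexists>k. layer {1..<d} k w0"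
  shows "\<exists>\<rho> f. ranked_path V D v d {..d} \<rho> f \<and> d - 1 \<le> card X \<and>
    (\<Sum>r\<in>{1..<d}. int r) \<le> (\<Sum>w\<in>X. int (gain f w))"
proof -
  define K where "K = {w \<in> X. \<nexists>k. layer {1..<d} k w}"
  define S0 where "S0 = {w \<in> K. D w (v 0) \<le> D w (v d)}"
  define S1 where "S1 = {w \<in> K. D w (v d) < D w (v 0)}"
  \<comment> \<open>Inside \<open>K\<close> the rank is the distance to the nearer end, so that
    chains stay in their half; elsewhere it is the rank towards the inner path.\<close>
  define \<rho> where "\<rho> w = (if w \<in> S0 then D w (v 0) else if w \<in> S1 then D w (v d) else rank {1..<d} w)"
    for w
  have S: "S0 \<inter> S1 = {}" "S0 \<subseteq> K" "S1 \<subseteq> K" "K = S0 \<union> S1" "K \<subseteq> X"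
    by (auto simp: S0_def S1_def K_def)
  have KV: "w \<in> X" "w \<in> V" if "w \<in> K" for w
    using that S X_subset by auto
  have ends: "v 0 \<in> V" "v d \<in> V"
    using v_in by auto
  have K_neighbour: "z \<in> K \<or> z = v 0 \<or> z = v d" if w: "w \<in> K" and z: "z \<in> V" "D w z = 1" for w z
    using z(1)
  proof (cases rule: V_cases)
    case (path i)
    then show ?thesis
      using layer_base[of w i "{1..<d}"] w z(2) by (cases "i = 0 \<or> i = d") (auto simp: K_def)
  next
    case off
    then show ?thesis
      using layer_step[of "{1..<d}" _ z w] w z(2) by (auto simp: K_def)
  qed
  have K_step: "(k = 0 \<and> D w (v t) = 1) \<or> (\<exists>z\<in>K. D w z = 1 \<and> D z (v t) = k)"
    if w: "w \<in> K" and t: "t \<in> {0, d}" and k: "D w (v t) = Suc k" for w t k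
  proof -
    have tV: "v t \<in> V"
      using t ends by auto
    obtain z where z: "z \<in> V" "D w z = 1" "D z (v t) = k"
      using D_step[OF KV(2)[OF w] tV k] by auto
    \<comment> \<open>A shortest walk to one end cannot begin with a step to the other end: its
      length would be \<open>d + 1\<close>.\<close>
    have "z \<noteq> v (d - t)"
    proof
      assume "z = v (d - t)"
      then have "k = d"
        using z(3) D_v[of "d - t" t] t by auto
      then show False
        using D_le[OF KV(2)[OF w] tV] k by simp
    qed
    then have "z \<in> K \<or> z = v t"
      using K_neighbour[OF w z(1,2)] t by auto
    then show ?thesis
      using z k D_eq_0_iff[OF tV tV] by auto
  qed
  have K_nonzero: "D w (v t) \<noteq> 0" if "w \<in> K" "t \<in> {0, d}" for w t
    using that KV[OF that(1)] X_not_P(2)[of w t] D_eq_0_iff[of w "v t"] v_in[of t] by auto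
  have K_lipschitz: "D w (v t) \<le> Suc (D z (v t))" if "w \<in> K" "z \<in> K" "D w z = 1" "t \<in> {0, d}" for w z t
    using D_triangle[of w z "v t"] KV that ends by auto
  have S0_step: "\<exists>x\<in>S0. D w x = 1 \<and> \<rho> x = Suc k" if w: "w \<in> S0" and k: "\<rho> w = Suc (Suc k)" for w k
  proof -
    have wK: "w \<in> K" "D w (v 0) = Suc (Suc k)" "D w (v 0) \<le> D w (v d)"
      using w k by (auto simp: S0_def \<rho>_def split: if_splits)
    obtain z where z: "z \<in> K" "D w z = 1" "D z (v 0) = Suc k"
      using K_step[OF wK(1) _ wK(2)] by auto
    then have "z \<in> S0"
      using K_lipschitz[OF wK(1) z(1,2), of d] wK by (auto simp: S0_def)
    then show ?thesis
      using z by (auto simp: \<rho>_def)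
  qed
  have S1_step: "\<exists>x\<in>S1. D w x = 1 \<and> \<rho> x = Suc k" if w: "w \<in> S1" and k: "\<rho> w = Suc (Suc k)" for w k
  proof -
    have wK: "w \<in> K" "D w (v d) = Suc (Suc k)" "D w (v d) < D w (v 0)"
      using w k S(1) by (auto simp: S1_def \<rho>_def S0_def split: if_splits)
    obtain z where z: "z \<in> K" "D w z = 1" "D z (v d) = Suc k"
      using K_step[OF wK(1) _ wK(2)] by auto
    then have "z \<in> S1"
      using K_lipschitz[OF wK(1) z(1,2), of 0] wK by (auto simp: S1_def)
    then show ?thesis
      using z S(1) by (auto simp: \<rho>_def)
  qed
  obtain f where f: "bij_betw f X {1..card X}" "\<forall>x\<in>X. \<forall>y\<in>X. \<rho> x < \<rho> y \<longrightarrow> f x < f y"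
    using exists_rank_enumeration[of X \<rho>] by auto
  interpret ranked_path V D v d "{..d}" \<rho> f
  proof
    fix w assume w: "w \<in> X"
    consider "w \<in> S0" | "w \<in> S1" "w \<notin> S0" | k where "w \<notin> S0" "w \<notin> S1" "layer {1..<d} k w"
      using w S(4) by (auto simp: K_def)
    note cases = this
    from cases show "1 \<le> \<rho> w"
    proof cases
      case 1
      then show ?thesis
        using K_nonzero[of w 0] S by (auto simp: \<rho>_def Suc_le_eq)
    next
      case 2
      then show ?thesis
        using K_nonzero[of w d] S by (auto simp: \<rho>_def Suc_le_eq)
    next
      case 3
      then show ?thesis
        using rank_ge_1 by (auto simp: \<rho>_def)
    qed
    from cases show "\<exists>j\<in>{..d}. D w (v j) = 1" if "\<rho> w = 1"
    proof cases
      case 3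
      then have "\<exists>j\<in>{1..<d}. D w (v j) = 1"
        using rank_1_attached[OF 3(3)] that by (auto simp: \<rho>_def)
      then show ?thesis
        by auto
    qed (use that in \<open>auto simp: \<rho>_def\<close>)
    from cases show "\<exists>x\<in>X. D w x = 1 \<and> \<rho> x = Suc l" if r: "\<rho> w = Suc (Suc l)" for l
    proof cases
      case 1
      then show ?thesis
        using S0_step[OF _ r] S(2,5) by blast
    next
      case 2
      then show ?thesis
        using S1_step[OF _ r] S(3,5) by blast
    next
      case 3
      then have "rank {1..<d} w = Suc (Suc l)"
        using r by (simp add: \<rho>_def)
      then obtain x where x: "x \<in> X" "D w x = 1" "rank {1..<d} x = Suc l" "\<exists>k. layer {1..<d} k x"
        using rank_predecessor[OF 3(3)] by blast
      then have "x \<notin> K"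
        by (auto simp: K_def)
      then have "\<rho> x = Suc l"
        using S x by (auto simp: \<rho>_def)
      then show ?thesis
        using x by blast
    qed
  qed (use f in auto)
  have closed: "step_closed S0" "step_closed S1"
    using S0_step S1_step S by (auto simp: step_closed_def)
  have \<rho>_S: "w \<in> S0 \<Longrightarrow> \<rho> w = D w (v 0)" "w \<in> S1 \<Longrightarrow> \<rho> w = D w (v d)" for w
    using S by (auto simp: \<rho>_def)
  \<comment> \<open>Walking from \<open>w\<close> towards \<open>v d\<close> inside
    \<open>K\<close>, one must change from \<open>S0\<close> to \<open>S1\<close>: an
    \<open>S0\<close> vertex next to \<open>v d\<close> would put the ends at distance at most
    2.\<close>
  have from_S0: "\<exists>x\<in>S0. \<exists>y\<in>S1. D x y = 1" if "w \<in> S0" for w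
    using that
  proof (induction "D w (v d)" arbitrary: w)
    case 0
    then show ?case
      using K_nonzero[of w d] S by auto
  next
    case (Suc k)
    have wK: "w \<in> K" "D w (v 0) \<le> D w (v d)"
      using Suc.prems by (auto simp: S0_def)
    have "D w (v d) \<noteq> 1"
      using D_triangle[of "v 0" w "v d"] D_sym[of "v 0" w] D_v[of 0 d] KV(2)[OF wK(1)] ends wK d by auto
    then obtain z where z: "z \<in> K" "D w z = 1" "D z (v d) = k"
      using K_step[OF wK(1), of d k] Suc.hyps(2) by auto
    then show ?case
      using Suc.hyps(1)[of z] Suc.prems S(4) by auto
  qed
  have from_S1: "\<exists>x\<in>S0. \<exists>y\<in>S1. D x y = 1" if "w \<in> S1" for w
    using that
  proof (induction "D w (v 0)" arbitrary: w)
    case 0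
    then show ?case
      using K_nonzero[of w 0] S by auto
  next
    case (Suc k)
    have wK: "w \<in> K" "D w (v d) < D w (v 0)"
      using Suc.prems by (auto simp: S1_def)
    have "D w (v 0) \<noteq> 1"
      using K_nonzero[OF wK(1), of d] wK by auto
    then obtain z where z: "z \<in> K" "D w z = 1" "D z (v 0) = k"
      using K_step[OF wK(1), of 0 k] Suc.hyps(2) by auto
    moreover have "D z w = 1"
      using z D_sym[of w z] KV wK by auto
    ultimately show ?case
      using Suc.hyps(1)[of z] Suc.prems S(4) by auto
  qed
  obtain x y where xy: "x \<in> S0" "y \<in> S1" "D x y = 1"
    using from_S0[of w0] from_S1[of w0] w0 S(4) by (auto simp: K_def)
  have yx: "D y x = 1"
    using xy D_sym[of x y] KV S by auto
  have "\<exists>u\<in>X. d - 1 \<le> card X \<and> (\<Sum>r\<in>{1..<d}. r) \<le> gain f u"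
  proof (cases "f x < f y")
    case True
    have "d - 1 \<le> card X" "(\<Sum>r\<in>{1..<d}. r) \<le> gain f y"
      using gain_between_chains[of 0 S0 S1 x y] closed \<rho>_S S(1) xy yx True by auto
    then show ?thesis
      using xy S by blast
  next
    case False
    then have "f y < f x"
      using xy S f_inj[of x y] by fastforce
    then have "d - 1 \<le> card X" "(\<Sum>r\<in>{1..<d}. r) \<le> gain f x"
      using gain_between_chains[of d S1 S0 y x] closed \<rho>_S S(1) xy by auto
    then show ?thesis
      using xy S by blast
  qed
  then obtain u where u: "u \<in> X" "d - 1 \<le> card X" "(\<Sum>r\<in>{1..<d}. r) \<le> gain f u"
    by blast
  have "int (gain f u) \<le> (\<Sum>w\<in>X. int (gain f w))"
    using u by (intro member_le_sum) auto
  moreover have "(\<Sum>r\<in>{1..<d}. int r) \<le> int (gain f u)"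
    using u(3) unfolding of_nat_sum[symmetric] of_nat_le_iff .
  ultimately show ?thesis
    using u(2) ranked_path_axioms by (meson order_trans)
qed

lemma excess_less_path:
  assumes X: "X \<noteq> {}" and card: "9 \<le> card V"
  shows "excess < path_distance_sum (card V) - 2 * path_ecc_sum (card V)"
proof -
  let ?m = "card X"
  have m: "1 \<le> ?m"
    using X by (simp add: Suc_le_eq card_gt_0_iff)
  have dm: "8 \<le> int d + int ?m"
    using card card_V by simp
  have path: "(\<Sum>i\<le>d. \<Sum>j\<le>d. int ((i - j) + (j - i))) = path_distance_sum (d + 1)"
    "(\<Sum>i\<le>d. int (max i (d - i))) = path_ecc_sum (d + 1)"
    by (simp_all add: path_distance_sum_def path_ecc_sum_def lessThan_Suc_atMost)
  have conclude: ?thesis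
    if f: "ranked_path V D v d T \<rho> f" and \<Gamma>: "\<Gamma> \<le> (\<Sum>w\<in>X. int (gain f w))"
      and less: "6 * (int d * int ?m) + 8 * int ?m + 3 * int ?m ^ 2 + 3 < 2 * int ?m ^ 3 + 12 * \<Gamma>"
    for T \<rho> f \<Gamma>
    using ranked_path.excess_le[OF f] path_value_gt[OF less] \<Gamma> unfolding path card_V
    by linarith
  consider "d \<le> 2" | "3 \<le> d" "\<forall>w\<in>X. \<exists>k. layer {1..<d} k w"
    | w where "3 \<le> d" "w \<in> X" "\<nexists>k. layer {1..<d} k w"
    by fastforce
  then show ?thesis
  proof cases
    case 1
    obtain \<rho> f where f: "ranked_path V D v d {..d} \<rho> f"
      using exists_ranked_path by blast
    show ?thesis
      using crude_inequality[OF _ dm] 1 by (intro conclude[OF f, of 0]) (auto intro: sum_nonneg)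
  next
    case 2
    obtain \<rho> f where f: "interior_ranked_path V D v d \<rho> f"
      using exists_interior_ranked_path 2 by blast
    interpret interior_ranked_path V D v d \<rho> f
      by (rule f)
    show ?thesis
    proof (rule conclude[OF ranked_path_axioms sum_gain_ge_quota[OF card]])
      show "6 * (int d * int ?m) + 8 * int ?m + 3 * int ?m ^ 2 + 3
          < 2 * int ?m ^ 3 + 12 * (\<Sum>k\<in>{1..?m}. quota k)"
        using interior_inequality[OF _ _ dm] sum_quota_eq[OF m] 2 m
        by (simp add: algebra_simps power2_eq_square)
    qed
  next
    case 3
    obtain \<rho> f where f: "ranked_path V D v d {..d} \<rho> f" "d - 1 \<le> ?m"
      and g: "(\<Sum>r\<in>{1..<d}. int r) \<le> (\<Sum>w\<in>X. int (gain f w))"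
      using exists_ranked_path_bypass[OF 3] by blast
    have gauss: "2 * (\<Sum>r\<in>{1..<k}. int r) = int k * (int k - 1)" if "1 \<le> k" for k
      using that by (induction k rule: nat_induct_at_least) (auto simp: algebra_simps)
    have "int d - 1 \<le> int ?m"
      using f(2) by linarith
    from cycle_inequality[OF this dm] show ?thesis
      using gauss[of d] 3(1) by (intro conclude[OF f(1) g]) (simp add: algebra_simps)
  qed
qed

end

section \<open>Extremality in the metric setting\<close>

context graph_metric
begin

lemma exists_diametral_path:
  assumes "V \<noteq> {}"
  shows "\<exists>v d. diametral_path V D v d"
proof -
  let ?S = "(\<lambda>(x, y). D x y) ` (V \<times> V)"
  have S: "finite ?S" "?S \<noteq> {}"
    using finite_V assms by auto
  obtain x y where xy: "x \<in> V" "y \<in> V" "D x y = Max ?S"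
    using Max_in[OF S] by auto
  obtain v where v: "\<And>i. i \<le> Max ?S \<Longrightarrow> v i \<in> V"
    "\<And>i j. i \<le> Max ?S \<Longrightarrow> j \<le> Max ?S \<Longrightarrow> D (v i) (v j) = (i - j) + (j - i)"
    using geodesic_exists[OF xy] by blast
  have "D a b \<le> Max ?S" if "a \<in> V" "b \<in> V" for a b
    using S(1) that by (intro Max_ge) auto
  then have "diametral_path V D v (Max ?S)"
    using v by unfold_locales auto
  then show ?thesis
    by blast
qed

lemma excess_isometric_path:
  assumes p: "bij_betw p {..<n} V"
    and Dp: "\<And>i j. i < n \<Longrightarrow> j < n \<Longrightarrow> D (p i) (p j) = (i - j) + (j - i)"
  shows "excess = path_distance_sum n - 2 * path_ecc_sum n"
proof -
  have reindex: "(\<Sum>x\<in>V. h x) = (\<Sum>i<n. h (p i))" for h :: "'a \<Rightarrow> int"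
    using sum.reindex_bij_betw[OF p, of h] by simp
  have "ecc (p i) = max i (n - 1 - i)" if i: "i < n" for i
  proof -
    have "D (p i) ` V = (\<lambda>j. (i - j) + (j - i)) ` {..<n}"
      using p Dp[OF i] by (auto simp: bij_betw_def image_image[symmetric] image_iff)
    then have "ecc (p i) = Max ((\<lambda>j. (i - j) + (j - i)) ` {..<n})"
      by (simp add: ecc_def)
    also have "\<dots> = max i (n - 1 - i)"
    proof (rule Max_eqI)
      show "max i (n - 1 - i) \<in> (\<lambda>j. (i - j) + (j - i)) ` {..<n}"
      proof (cases "n - 1 - i \<le> i")
        case True
        then show ?thesis
          using i by (intro image_eqI[of _ _ 0]) auto
      next
        case False
        then show ?thesis
          using i by (intro image_eqI[of _ _ "n - 1"]) auto
      qed
    qed (use i in auto)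
    finally show ?thesis .
  qed
  then show ?thesis
    by (simp add: excess_def reindex Dp path_distance_sum_def path_ecc_sum_def)
qed

theorem excess_extremal:
  assumes "9 \<le> card V"
  shows "excess < path_distance_sum (card V) - 2 * path_ecc_sum (card V) \<or>
    (\<exists>p. bij_betw p {..<card V} V \<and>
      (\<forall>i<card V. \<forall>j<card V. D (p i) (p j) = (i - j) + (j - i)))"
proof -
  have "V \<noteq> {}"
    using assms by auto
  then obtain v d where "diametral_path V D v d"
    using exists_diametral_path by blast
  then interpret diametral_path V D v d .
  show ?thesis
  proof (cases "X = {}")
    case True
    then have "card V = Suc d" "P = V"
      using card_V P_Un_X by auto
    then have "bij_betw v {..<card V} V"
      using inj_v by (simp add: bij_betw_def lessThan_Suc_atMost P_def)
    then show ?thesis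
      using D_v \<open>card V = Suc d\<close> by (auto simp: less_Suc_eq_le)
  next
    case False
    then show ?thesis
      using excess_less_path assms by blast
  qed
qed

end

section \<open>Hop distance in graphs\<close>

context graph_metric
begin

text \<open>Adjacent vertices have neighbouring indices, so getting from \<open>p i\<close> to
  \<open>p j\<close> takes at least |i - j| steps, and walking through the indices in between
  attains this.\<close>

lemma isometric_path_if_adjacent:
  assumes p: "bij_betw p {..<n} V"
    and adj: "\<And>i j. i < n \<Longrightarrow> j < n \<Longrightarrow> D (p i) (p j) = 1 \<longleftrightarrow> j = Suc i \<or> i = Suc j"
    and ij: "i < n" "j < n"
  shows "D (p i) (p j) = (i - j) + (j - i)"
proof (rule antisym)
  have pV: "p i \<in> V" if "i < n" for i
    using p that by (auto simp: bij_betw_def)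
  have up: "D (p i) (p (i + k)) \<le> k" if "i + k < n" for i k
    using that
  proof (induction k)
    case 0
    then show ?case
      using D_eq_0_iff pV by auto
  next
    case (Suc k)
    then show ?case
      using D_triangle[of "p i" "p (i + k)" "p (Suc (i + k))"] pV adj[of "i + k" "Suc (i + k)"]
      by auto
  qed
  show "D (p i) (p j) \<le> (i - j) + (j - i)"
  proof (cases "i \<le> j")
    case True
    then show ?thesis
      using up[of i "j - i"] ij by auto
  next
    case False
    then show ?thesis
      using up[of j "i - j"] ij D_sym[of "p i" "p j"] pV by auto
  qed
  show "(i - j) + (j - i) \<le> D (p i) (p j)"
    using ij(1)
  proof (induction "D (p i) (p j)" arbitrary: i)
    case 0
    then show ?case
      using D_eq_0_iff[of "p i" "p j"] pV ij(2) p by (auto simp: bij_betw_def inj_on_def)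
  next
    case (Suc k)
    obtain z where z: "z \<in> V" "D (p i) z = 1" "D z (p j) = k"
      using D_step[OF pV pV, of i j k] Suc ij(2) by auto
    obtain l where l: "l < n" "z = p l"
      using z(1) p by (auto simp: bij_betw_def)
    then show ?case
      using Suc.hyps(1)[of l] Suc.hyps(2) z adj[of i l] Suc.prems by auto
  qed
qed

end

text \<open>Adding \<open>a\<close> to \<open>A\<close> creates exactly the pairs
  \<open>{a, x}\<close> with \<open>x\<close> in \<open>A\<close>, each met twice by the double
  sum.\<close>

lemma sum_pairs_eq_sum_two_subsets:
  fixes g :: "'a \<Rightarrow> 'a \<Rightarrow> real"
  assumes "finite A" "\<And>x. g x x = 0" "\<And>x y. g x y = g y x" "\<And>x y. h {x, y} = g x y"
  shows "(\<Sum>x\<in>A. \<Sum>y\<in>A. g x y) = 2 * (\<Sum>e | e \<subseteq> A \<and> card e = 2. h e)"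
  using assms(1)
proof (induction A rule: finite_induct)
  case empty
  have "(\<Sum>e | e \<subseteq> {} \<and> card e = 2. h e) = 0"
    by (rule sum.neutral) auto
  then show ?case
    by (simp only: sum.empty mult_zero_right)
next
  case (insert a A)
  have split: "{e. e \<subseteq> insert a A \<and> card e = 2} = {e. e \<subseteq> A \<and> card e = 2} \<union> (\<lambda>x. {a, x}) ` A"
    using insert.hyps by (auto simp: card_2_iff doubleton_eq_iff)
  have "(\<Sum>e | e \<subseteq> insert a A \<and> card e = 2. h e)
      = (\<Sum>e | e \<subseteq> A \<and> card e = 2. h e) + (\<Sum>e\<in>(\<lambda>x. {a, x}) ` A. h e)"
    unfolding split using insert.hyps by (intro sum.union_disjoint) auto
  also have "(\<Sum>e\<in>(\<lambda>x. {a, x}) ` A. h e) = (\<Sum>x\<in>A. g a x)"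
    using insert.hyps by (subst sum.reindex) (auto simp: inj_on_def doubleton_eq_iff assms(4))
  finally show ?case
    using insert assms(2) assms(3)[of _ a] by (simp add: sum.distrib)
qed

text \<open>A natural-number version of \<open>gdist\<close>, matching the abstract metric; the two
  agree wherever a walk exists.\<close>

definition hops :: "('a, 'b) pre_digraph \<Rightarrow> 'a \<Rightarrow> 'a \<Rightarrow> nat" where
  "hops G u v = (LEAST k. \<exists>p. pre_digraph.awalk G u p v \<and> length p = k)"

context pseudo_graph
begin

lemma hops_le: "awalk u p v \<Longrightarrow> hops G u v \<le> length p"
  unfolding hops_def by (rule Least_le) blast

lemma hops_attained: "awalk u p v \<Longrightarrow> \<exists>q. awalk u q v \<and> length q = hops G u v"
  unfolding hops_def by (rule LeastI_ex) blast

lemma awalk_exists: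
  assumes "connected G" "u \<in> verts G" "v \<in> verts G"
  shows "\<exists>p. awalk u p v"
proof -
  have "u \<rightarrow>\<^sup>*\<^bsub>mk_symmetric G\<^esub> v"
    using assms by (auto simp: connected_def strongly_connected_def)
  then show ?thesis
    using reachable_mk_symmetric_eq[OF sym_arcs] reachable_awalk by blast
qed

lemma gdist_eq_hops:
  assumes "awalk u p v"
  shows "gdist G u v = real (hops G u v)"
proof -
  have cost: "awalk_cost (\<lambda>_. 1) p = real (length p)" for p
    by (induction p) auto
  obtain q where q: "awalk u q v" "length q = hops G u v"
    using hops_attained[OF assms] by blast
  have "\<mu> (\<lambda>_. 1) u v = ereal (real (hops G u v))"
  proof (rule antisym)
    show "\<mu> (\<lambda>_. 1) u v \<le> ereal (real (hops G u v))"
      using min_cost_le_walk_cost[OF q(1), of "\<lambda>_. 1"] q(2) by (simp add: cost)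
    show "ereal (real (hops G u v)) \<le> \<mu> (\<lambda>_. 1) u v"
      unfolding \<mu>_def by (rule INF_greatest) (auto simp: cost hops_le)
  qed
  then show ?thesis
    by (simp add: gdist_def)
qed

lemma graph_metric_hops:
  assumes conn: "connected G"
  shows "graph_metric (verts G) (hops G)"
proof
  show "finite (verts G)"
    by simp
next
  fix u v assume uv: "u \<in> verts G" "v \<in> verts G"
  obtain p where p: "awalk u p v" "length p = hops G u v"
    using awalk_exists[OF conn uv] hops_attained by blast
  show zero: "hops G u v = 0 \<longleftrightarrow> u = v"
    using p hops_le[of u "[]" u] uv by (auto simp: awalk_Nil_iff)
  show "hops G u v = hops G v u"
    using gdist_commute[of u v] gdist_eq_hops awalk_exists[OF conn uv]
      awalk_exists[OF conn uv(2,1)] by (metis of_nat_eq_iff)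
  fix k assume k: "hops G u v = Suc k"
  then obtain e q where eq: "p = e # q"
    using p by (cases p) auto
  then have e: "e \<in> arcs G" "tail G e = u" "awalk (head G e) q v"
    using p by (auto simp: awalk_Cons_iff)
  have e_walk: "awalk u [e] (head G e)"
    using e by (auto simp: awalk_Cons_iff awalk_Nil_iff)
  obtain q' where q': "awalk (head G e) q' v" "length q' = hops G (head G e) v"
    using hops_attained[OF e(3)] by blast
  obtain r where r: "awalk u r (head G e)" "length r = hops G u (head G e)"
    using hops_attained[OF e_walk] by blast
  \<comment> \<open>The two parts have lengths at most 1 and \<open>k\<close> but must together
    reach \<open>Suc k\<close>, so both bounds are attained.\<close>
  have "hops G u v \<le> length r + length q'"
    using hops_le[OF awalk_appendI[OF r(1) q'(1)]] by simp
  moreover have "hops G u (head G e) \<le> 1" "hops G (head G e) v \<le> k"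
    using hops_le[OF e_walk] hops_le[OF e(3)] p eq k by auto
  ultimately have "hops G u (head G e) = 1 \<and> hops G (head G e) v = k"
    using k r(2) q'(2) by simp
  then show "\<exists>z\<in>verts G. hops G u z = 1 \<and> hops G z v = k"
    using head_in_verts[OF e(1)] by blast
next
  fix u v w assume uvw: "u \<in> verts G" "v \<in> verts G" "w \<in> verts G"
  obtain p where p: "awalk u p v" "length p = hops G u v"
    using awalk_exists[OF conn uvw(1,2)] hops_attained by blast
  obtain q where q: "awalk v q w" "length q = hops G v w"
    using awalk_exists[OF conn uvw(2,3)] hops_attained by blast
  show "hops G u w \<le> hops G u v + hops G v w"
    using hops_le[OF awalk_appendI[OF p(1) q(1)]] p q by simp
qed

lemma wiener_minus_ecc_eq:
  assumes conn: "connected G"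
  shows "2 * (wiener_index G - total_eccentricity G) = of_int (graph_metric.excess (verts G) (hops G))"
proof -
  interpret graph_metric "verts G" "hops G"
    by (rule graph_metric_hops[OF conn])
  have gdist: "gdist G u v = real (hops G u v)" if "u \<in> verts G" "v \<in> verts G" for u v
    using awalk_exists[OF conn that] gdist_eq_hops by blast
  \<comment> \<open>For a point outside the graph the infimum over no walks is \<infinity>, which
    \<open>real_of_ereal\<close> sends to 0; the pair-sum lemma asks for 0 at every point of the
    type.\<close>
  have zero: "gdist G u u = 0" for u
  proof (cases "u \<in> verts G")
    case True
    then show ?thesis
      using gdist D_eq_0_iff by simp
  next
    case False
    then have "{p. awalk u p u} = {}"
      using awalk_hd_in_verts by blast
    then show ?thesis
      by (simp add: gdist_def \<mu>_def top_ereal_def)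
  qed
  have "2 * wiener_index G = (\<Sum>u\<in>verts G. \<Sum>v\<in>verts G. gdist G u v)"
    unfolding wiener_index_def
    using sum_pairs_eq_sum_two_subsets[of "verts G" "gdist G" "pair_dist G"] zero gdist_commute
      pair_dist_eq by simp
  also have "\<dots> = (\<Sum>u\<in>verts G. \<Sum>v\<in>verts G. real (hops G u v))"
    using gdist by (intro sum.cong refl) auto
  finally have W: "2 * wiener_index G = (\<Sum>u\<in>verts G. \<Sum>v\<in>verts G. real (hops G u v))" .
  have "eccentricity G v = real (ecc v)" if v: "v \<in> verts G" for v
  proof -
    have "(\<lambda>u. gdist G u v) ` verts G = real ` hops G v ` verts G"
      using gdist v D_sym by (auto simp: image_image)
    then have "eccentricity G v = Max (real ` hops G v ` verts G)"
      by (simp add: eccentricity_def)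
    also have "\<dots> = real (Max (hops G v ` verts G))"
      using v by (intro mono_Max_commute[symmetric]) (auto simp: mono_def)
    finally show ?thesis
      by (simp add: ecc_def)
  qed
  then show ?thesis
    using W by (simp add: total_eccentricity_def excess_def)
qed

end

section \<open>Path graphs and isomorphism with them\<close>

lemma graph_path_graph: "Digraph.graph (path_graph n)"
proof -
  have "{(i, j). i < n \<and> j < n \<and> (j = Suc i \<or> i = Suc j)} \<subseteq> {..<n} \<times> {..<n}"
    by auto
  then have "finite {(i, j). i < n \<and> j < n \<and> (j = Suc i \<or> i = Suc j)}"
    by (rule finite_subset) simp
  then show ?thesis
    unfolding path_graph_def
    by unfold_locales (auto simp: arc_to_ends_def symmetric_def sym_def)
qed

lemma arcs_ends_path_graph:
  "arcs_ends (path_graph n) = {(i, j). i < n \<and> j < n \<and> (j = Suc i \<or> i = Suc j)}"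
  by (simp add: path_graph_def)

lemma verts_path_graph: "verts (path_graph n) = {..<n}"
  by (simp add: path_graph_def)

lemma connected_path_graph:
  assumes "1 \<le> n"
  shows "connected (path_graph n)"
proof -
  interpret P: graph "path_graph n"
    by (rule graph_path_graph)
  have from_0: "0 \<rightarrow>\<^sup>*\<^bsub>path_graph n\<^esub> i" if "i < n" for i
    using that
  proof (induction i)
    case 0
    then show ?case
      by (simp add: verts_path_graph)
  next
    case (Suc i)
    then have "i \<rightarrow>\<^bsub>path_graph n\<^esub> Suc i"
      by (simp add: arcs_ends_path_graph)
    then show ?case
      using Suc P.reachable_adj_trans by auto
  qed
  have "i \<rightarrow>\<^sup>*\<^bsub>path_graph n\<^esub> j" if "i < n" "j < n" for i j
    by (rule P.reachable_trans[OF P.symmetric_reachable'[OF from_0] from_0]) (use that in auto)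
  then show ?thesis
    using assms unfolding connected_def strongly_connected_def
    by (auto simp: P.reachable_mk_symmetric_eq[OF P.sym_arcs] verts_path_graph lessThan_empty_iff)
qed

context graph
begin

lemma hops_eq_1_iff:
  assumes "connected G" "u \<in> verts G" "v \<in> verts G"
  shows "hops G u v = 1 \<longleftrightarrow> (u, v) \<in> arcs_ends G"
proof
  assume 1: "hops G u v = 1"
  obtain p where "awalk u p v"
    using awalk_exists[OF assms] by blast
  from hops_attained[OF this] 1 obtain q where "awalk u q v" "length q = Suc 0"
    by auto
  then show "(u, v) \<in> arcs_ends G"
    by (auto simp: length_Suc_conv awalk_Cons_iff awalk_Nil_iff arcs_ends_conv)
next
  assume "(u, v) \<in> arcs_ends G"
  then obtain e where e: "e \<in> arcs G" "tail G e = u" "head G e = v"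
    by (auto simp: arcs_ends_conv)
  then have w: "awalk u [e] v"
    by (auto simp: awalk_Cons_iff awalk_Nil_iff)
  then obtain q where q: "awalk u q v" "length q = hops G u v"
    using hops_attained by blast
  have "u \<noteq> v"
    using no_loops[OF e(1)] e by simp
  then have "q \<noteq> []"
    using q by (auto simp: awalk_Nil_iff)
  then have "hops G u v \<noteq> 0"
    using q(2)[symmetric] by simp
  then show "hops G u v = 1"
    using hops_le[OF w] by simp
qed

text \<open>An isomorphism transports adjacency, and adjacency along the numbering already
  determines all distances.\<close>

lemma digraph_iso_path_graph_imp_isometric:
  assumes conn: "connected G" and iso: "digraph_iso G (path_graph n)"
  shows "\<exists>p. bij_betw p {..<n} (verts G) \<and>
    (\<forall>i<n. \<forall>j<n. hops G (p i) (p j) = (i - j) + (j - i))"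
proof -
  interpret graph_metric "verts G" "hops G"
    by (rule graph_metric_hops[OF conn])
  obtain h where h: "digraph_isomorphism h" "path_graph n = app_iso h G"
    using iso by (auto simp: digraph_iso_def)
  let ?h = "iso_verts h"
  have "?h ` verts G = {..<n}"
    using h(2) verts_path_graph by (metis verts_app_iso)
  then have bij: "bij_betw ?h (verts G) {..<n}"
    using h(1) by (simp add: bij_betw_def digraph_isomorphism_def)
  define p where "p = the_inv_into (verts G) ?h"
  have p: "bij_betw p {..<n} (verts G)"
    unfolding p_def by (rule bij_betw_the_inv_into[OF bij])
  have pV: "p i \<in> verts G" "?h (p i) = i" if "i < n" for i
    using that p bij f_the_inv_into_f_bij_betw[OF bij] by (auto simp: p_def bij_betw_def)
  have "arcs_ends (path_graph n) = (\<lambda>(u, v). (?h u, ?h v)) ` arcs_ends G"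
    unfolding h(2) by (rule arcs_ends_app_iso_eq[OF h(1)])
  moreover have "inj_on (\<lambda>(u, v). (?h u, ?h v)) (verts G \<times> verts G)"
    using bij by (auto simp: inj_on_def bij_betw_def)
  moreover have "arcs_ends G \<subseteq> verts G \<times> verts G"
    by (auto simp: arcs_ends_conv)
  ultimately have ends: "(u, v) \<in> arcs_ends G \<longleftrightarrow> (?h u, ?h v) \<in> arcs_ends (path_graph n)"
    if "u \<in> verts G" "v \<in> verts G" for u v
    using that inj_on_image_mem_iff[of "\<lambda>(u, v). (?h u, ?h v)" "verts G \<times> verts G" "(u, v)" "arcs_ends G"]
    by simp
  have "hops G (p i) (p j) = 1 \<longleftrightarrow> j = Suc i \<or> i = Suc j" if "i < n" "j < n" for i j
    using hops_eq_1_iff[OF conn] ends pV that by (simp add: arcs_ends_path_graph)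
  then show ?thesis
    using isometric_path_if_adjacent[OF p] p by blast
qed

lemma digraph_iso_path_graph_if_isometric:
  assumes conn: "connected G" and p: "bij_betw p {..<n} (verts G)"
    and Dp: "\<And>i j. i < n \<Longrightarrow> j < n \<Longrightarrow> hops G (p i) (p j) = (i - j) + (j - i)"
  shows "digraph_iso G (path_graph n)"
proof -
  define q where "q = the_inv_into {..<n} p"
  have q: "bij_betw q (verts G) {..<n}"
    unfolding q_def by (rule bij_betw_the_inv_into[OF p])
  have qV: "q u < n" "p (q u) = u" if "u \<in> verts G" for u
    using that q f_the_inv_into_f_bij_betw[OF p] by (auto simp: q_def bij_betw_def)
  have pq: "q (p i) = i" if "i < n" for i
    using that p by (simp add: q_def the_inv_into_f_f bij_betw_def)
  have pV: "p i \<in> verts G" if "i < n" for i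
    using that p by (auto simp: bij_betw_def)
  have ends: "(p i, p j) \<in> arcs_ends G \<longleftrightarrow> j = Suc i \<or> i = Suc j" if "i < n" "j < n" for i j
    using hops_eq_1_iff[OF conn pV pV, of i j] Dp[OF that] that by auto
  \<comment> \<open>The arcs of \<open>path_graph n\<close> are pairs of numbers, so an arc is sent
    to the numbers of its two ends; this is injective because parallel arcs are excluded.\<close>
  define h where "h = \<lparr> iso_verts = q, iso_arcs = (\<lambda>a. (q (tail G a), q (head G a))),
    iso_head = snd, iso_tail = fst \<rparr>"
  have "inj_on (iso_arcs h) (arcs G)"
  proof (rule inj_onI)
    fix a b assume ab: "a \<in> arcs G" "b \<in> arcs G" "iso_arcs h a = iso_arcs h b"
    then have "tail G a = tail G b" "head G a = head G b"
      using q by (auto simp: h_def bij_betw_def inj_on_def)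
    then show "a = b"
      using no_multi_arcs[OF ab(1,2)] by (simp add: arc_to_ends_def)
  qed
  then have "digraph_isomorphism h"
    using q wf_digraph by (auto simp: digraph_isomorphism_def h_def bij_betw_def)
  moreover have "path_graph n = app_iso h G"
  proof (rule pre_digraph.equality)
    show "verts (path_graph n) = verts (app_iso h G)"
      using q by (simp add: verts_path_graph h_def bij_betw_def)
    have "iso_arcs h ` arcs G = (\<lambda>(u, v). (q u, q v)) ` arcs_ends G"
      by (auto simp: h_def arcs_ends_conv image_image)
    also have "\<dots> = {(i, j). i < n \<and> j < n \<and> (j = Suc i \<or> i = Suc j)}" (is "?A = ?B")
    proof
      show "?A \<subseteq> ?B"
      proof
        fix x assume "x \<in> ?A"
        then obtain u v where uv: "(u, v) \<in> arcs_ends G" "x = (q u, q v)"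
          by auto
        then have "u \<in> verts G" "v \<in> verts G"
          by (auto simp: arcs_ends_conv)
        then show "x \<in> ?B"
          using uv qV ends[of "q u" "q v"] by auto
      qed
      show "?B \<subseteq> ?A"
      proof
        fix x assume "x \<in> ?B"
        then obtain i j where ij: "x = (i, j)" "i < n" "j < n" "(p i, p j) \<in> arcs_ends G"
          using ends by auto
        then show "x \<in> ?A"
          using pq by (intro image_eqI[of _ _ "(p i, p j)"]) auto
      qed
    qed
    finally show "arcs (path_graph n) = arcs (app_iso h G)"
      by (simp add: path_graph_def)
  qed (simp_all add: path_graph_def h_def)
  ultimately show ?thesis
    by (auto simp: digraph_iso_def)
qed

end

lemma path_graph_value:
  assumes "1 \<le> n"
  shows "2 * (wiener_index (path_graph n) - total_eccentricity (path_graph n))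
    = of_int (path_distance_sum n - 2 * path_ecc_sum n)"
proof -
  interpret P: graph "path_graph n"
    by (rule graph_path_graph)
  note conn = connected_path_graph[OF assms]
  interpret graph_metric "verts (path_graph n)" "hops (path_graph n)"
    by (rule P.graph_metric_hops[OF conn])
  have bij: "bij_betw (\<lambda>i. i) {..<n} (verts (path_graph n))"
    by (simp add: verts_path_graph bij_betw_def)
  have "excess = path_distance_sum n - 2 * path_ecc_sum n"
    using P.hops_eq_1_iff[OF conn]
    by (intro excess_isometric_path[OF bij] isometric_path_if_adjacent[OF bij])
      (auto simp: arcs_ends_path_graph verts_path_graph)
  then show ?thesis
    using P.wiener_minus_ecc_eq[OF conn] by simp
qed

theorem theorem15:
  fixes n :: nat
  assumes "n \<ge> 9"
  shows "Digraph.graph (path_graph n) \<and> Digraph_Component.connected (path_graph n) \<and>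
    card (verts (path_graph n)) = n \<and>
    (\<forall>G :: ('a,'b) pre_digraph.
       Digraph.graph G \<and> Digraph_Component.connected G \<and> card (verts G) = n \<longrightarrow>
         wiener_index G - total_eccentricity G
           \<le> wiener_index (path_graph n) - total_eccentricity (path_graph n) \<and>
         (wiener_index G - total_eccentricity G
             = wiener_index (path_graph n) - total_eccentricity (path_graph n)
           \<longleftrightarrow> digraph_iso G (path_graph n)))"
proof (intro conjI allI impI)
  show "Digraph.graph (path_graph n)"
    by (rule graph_path_graph)
  show "connected (path_graph n)"
    using assms by (intro connected_path_graph) simp
  show "card (verts (path_graph n)) = n"
    by (simp add: verts_path_graph)
  have path: "2 * (wiener_index (path_graph n) - total_eccentricity (path_graph n))
      = of_int (path_distance_sum n - 2 * path_ecc_sum n)"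
    using assms by (intro path_graph_value) simp
  fix G :: "('a, 'b) pre_digraph"
  assume G: "Digraph.graph G \<and> connected G \<and> card (verts G) = n"
  then interpret graph G
    by blast
  interpret graph_metric "verts G" "hops G"
    using graph_metric_hops G by blast
  have excess: "2 * (wiener_index G - total_eccentricity G) = of_int excess"
    using wiener_minus_ecc_eq G by blast
  have iso: "digraph_iso G (path_graph n) \<longleftrightarrow> (\<exists>p. bij_betw p {..<n} (verts G) \<and>
      (\<forall>i<n. \<forall>j<n. hops G (p i) (p j) = (i - j) + (j - i)))"
    using digraph_iso_path_graph_imp_isometric digraph_iso_path_graph_if_isometric G by blast
  have eq: "excess = path_distance_sum n - 2 * path_ecc_sum n" if "digraph_iso G (path_graph n)"
    using that iso excess_isometric_path by blast
  \<comment> \<open>Strictness for every graph not isomorphic to the path yields both the maximum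
    and its uniqueness.\<close>
  have less: "excess < path_distance_sum n - 2 * path_ecc_sum n" if "\<not> digraph_iso G (path_graph n)"
    using that iso excess_extremal G assms by blast
  have "wiener_index G - total_eccentricity G
      \<le> wiener_index (path_graph n) - total_eccentricity (path_graph n) \<and>
    (wiener_index G - total_eccentricity G
      = wiener_index (path_graph n) - total_eccentricity (path_graph n)
    \<longleftrightarrow> digraph_iso G (path_graph n))"
  proof (cases "digraph_iso G (path_graph n)")
    case True
    then show ?thesis
      using eq[OF True] excess path by simp
  next
    case False
    have "real_of_int excess < of_int (path_distance_sum n - 2 * path_ecc_sum n)"
      using less[OF False] by (simp only: of_int_less_iff)
    then have "2 * (wiener_index G - total_eccentricity G)
        < 2 * (wiener_index (path_graph n) - total_eccentricity (path_graph n))"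
      by (simp only: excess path)
    then show ?thesis
      using False by simp
  qed
  then show "wiener_index G - total_eccentricity G
      \<le> wiener_index (path_graph n) - total_eccentricity (path_graph n)"
    and "wiener_index G - total_eccentricity G
      = wiener_index (path_graph n) - total_eccentricity (path_graph n)
    \<longleftrightarrow> digraph_iso G (path_graph n)"
    by blast+
qed

end
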